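(* Let $g\geq 3$, and put $N_g^{+}=2^{g-1}(2^g+1)$ and $N_g^{-}=2^{g-1}(2^g-1)$. (1) $O_{2g}^{-}(\mathbb{F}_2)$ is the unique subgroup of $\mathrm{Sp}_{2g}(\mathbb{F}_2)$ of index $N_g^{-}$, up to conjugation. (2) $O_{2g}^{+}(\mathbb{F}_2)$ is the unique subgroup of $\mathrm{Sp}_{2g}(\mathbb{F}_2)$ of index $N_g^{+}$, up to conjugation. (3) All the other proper subgroups of $\mathrm{Sp}_{2g}(\mathbb{F}_2)$ are of index at least $2N_g^{-}$.
   Context: $\mathrm{Sp}_{2g}(\mathbb{F}_2)$ is the group of linear automorphisms of $\mathbb{F}_2^{2g}$ preserving a fixed nondegenerate alternating bilinear form $\langle\cdot,\cdot\rangle$. A quadratic form $Q$ on $\mathbb{F}_2^{2g}$ polarizes to $\langle\cdot,\cdot\rangle$ if $Q(x+y)-Q(x)-Q(y)=\langle x,y\rangle$ for all $x,y$. $O_{2g}^{+}(\mathbb{F}_2)$ (resp. $O_{2g}^{-}(\mathbb{F}_2)$) is the subgroup of $\mathrm{Sp}_{2g}(\mathbb{F}_2)$ stabilizing a quadratic form polarizing to $\langle\cdot,\cdot\rangle$ of Witt index $g$ (resp. $g-1$); each is well defined up to conjugation in $\mathrm{Sp}_{2g}(\mathbb{F}_2)$. *)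

theory Defs
  imports
    "HOL-Analysis.Analysis"
    "HOL-Algebra.Coset"
    "HOL-Library.Z2"
begin

definition bilinear_form :: "('a::field ^ 'n \<Rightarrow> 'a ^ 'n \<Rightarrow> 'a) \<Rightarrow> bool" where
  "bilinear_form B \<longleftrightarrow>
     (\<forall>x. Vector_Spaces.linear (*s) (*) (\<lambda>y. B x y)) \<and>
     (\<forall>y. Vector_Spaces.linear (*s) (*) (\<lambda>x. B x y))"

definition alternating_form :: "('a::field ^ 'n \<Rightarrow> 'a ^ 'n \<Rightarrow> 'a) \<Rightarrow> bool" where
  "alternating_form B \<longleftrightarrow> bilinear_form B \<and> (\<forall>x. B x x = 0)"

definition nondegenerate :: "('a::field ^ 'n \<Rightarrow> 'a ^ 'n \<Rightarrow> 'a) \<Rightarrow> bool" where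
  "nondegenerate B \<longleftrightarrow>
     (\<forall>x. (\<forall>y. B x y = 0) \<longrightarrow> x = 0) \<and> (\<forall>y. (\<forall>x. B x y = 0) \<longrightarrow> y = 0)"

definition Sp :: "('a::field ^ 'n \<Rightarrow> 'a ^ 'n \<Rightarrow> 'a) \<Rightarrow> ('a ^ 'n \<Rightarrow> 'a ^ 'n) monoid" where
  "Sp B = \<lparr>carrier = {f. Vector_Spaces.linear (*s) (*s) f \<and> bij f \<and> (\<forall>x y. B (f x) (f y) = B x y)},
           mult = (\<circ>), one = id\<rparr>"

definition quadratic_form :: "('a::field ^ 'n \<Rightarrow> 'a) \<Rightarrow> bool" where
  "quadratic_form Q \<longleftrightarrow>
     (\<forall>a x. Q (a *s x) = a^2 * Q x) \<and> bilinear_form (\<lambda>x y. Q (x + y) - Q x - Q y)"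

definition polarizes_to :: "('a::field ^ 'n \<Rightarrow> 'a) \<Rightarrow> ('a ^ 'n \<Rightarrow> 'a ^ 'n \<Rightarrow> 'a) \<Rightarrow> bool" where
  "polarizes_to Q B \<longleftrightarrow> (\<forall>x y. Q (x + y) - Q x - Q y = B x y)"

(* The largest dimension of a totally singular subspace. In characteristic 2 total singularity
   has to be stated with Q itself, since isotropy for the polar form is weaker. *)
definition witt_index :: "('a::field ^ 'n \<Rightarrow> 'a) \<Rightarrow> nat" where
  "witt_index Q = Max {vec.dim S |S. vec.subspace S \<and> (\<forall>x\<in>S. Q x = 0)}"

definition form_stabilizer ::
  "('a::field ^ 'n \<Rightarrow> 'a ^ 'n \<Rightarrow> 'a) \<Rightarrow> ('a ^ 'n \<Rightarrow> 'a) \<Rightarrow> ('a ^ 'n \<Rightarrow> 'a ^ 'n) set" where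
  "form_stabilizer B Q = {f \<in> carrier (Sp B). \<forall>x. Q (f x) = Q x}"

(* The orthogonal subgroups of Sp B attached to the quadratic forms of Witt index w polarizing
   to B. In dimension 2g over the field with two elements, w = g gives the groups O^+ and
   w = g - 1 the groups O^-; each is defined only up to conjugation, so this is a set of
   subgroups. *)
definition orthogonal_subgroups ::
  "('a::field ^ 'n \<Rightarrow> 'a ^ 'n \<Rightarrow> 'a) \<Rightarrow> nat \<Rightarrow> ('a ^ 'n \<Rightarrow> 'a ^ 'n) set set" where
  "orthogonal_subgroups B w =
     {form_stabilizer B Q |Q. quadratic_form Q \<and> polarizes_to Q B \<and> witt_index Q = w}"

definition subgroup_index :: "('a, 'b) monoid_scheme \<Rightarrow> 'a set \<Rightarrow> nat" where
  "subgroup_index G H = card (rcosets\<^bsub>G\<^esub> H)"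

definition conjugate_subgroups :: "('a, 'b) monoid_scheme \<Rightarrow> 'a set \<Rightarrow> 'a set \<Rightarrow> bool" where
  "conjugate_subgroups G H K \<longleftrightarrow> (\<exists>x\<in>carrier G. K = x <#\<^bsub>G\<^esub> (H #>\<^bsub>G\<^esub> inv\<^bsub>G\<^esub> x))"

(* Existence of the subgroup K of index N is part of the claim. *)
definition unique_subgroup_of_index_upto_conj ::
  "('a, 'b) monoid_scheme \<Rightarrow> 'a set \<Rightarrow> nat \<Rightarrow> bool" where
  "unique_subgroup_of_index_upto_conj G K N \<longleftrightarrow>
     subgroup K G \<and> subgroup_index G K = N \<and>
     (\<forall>H. subgroup H G \<and> subgroup_index G H = N \<longrightarrow> conjugate_subgroups G K H)"

end

(* Let H be a proper subgroup of index less than 2 N^- = 4^g - 2^g. For a nonzero vector v let U_v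
   be the unipotent radical of the stabilizer P_v of v. The P_v-orbit of the base point of the coset
   space has at least [U_v : H \<inter> U_v] times as many points as the image of H \<inter> U_v in v^perp / v has
   translates under P_v, and the index bound leaves four possibilities for H \<inter> U_v. Playing them off
   against each other on totally isotropic planes produces an H-invariant nonempty set of nonzero
   vectors meeting every isotropic plane in 0 or 2 vectors: the vectors v with H \<inter> U_v = 1 if there
   are any, and otherwise the vectors whose transvection lies in H. The indicator function of such a
   set is additive on orthogonal pairs, hence it is linear or it polarizes to the symplectic form.
   In the linear case H fixes a nonzero vector and its index is at least 4^g - 1, so H lies in the
   stabilizer of a quadratic form, with equality since a proper subgroup of that stabilizer has index
   at least 2 N^-.

   The forms polarizing to B are the Q + B(-,a). The sum of (-1)^Q(x) over all x is 2^g or -2^g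
   according to the Witt index, and it is multiplied by (-1)^Q(a) when Q is replaced by Q + B(-,a).
   If Q(a) = 0 the transvection at a carries Q to Q + B(-,a). *)
theory Submission
  imports Defs
begin

text \<open>Scalars are truth values, so \<open>\<noteq>\<close> between them is addition in F_2.
  The obstacle is to read off H from its local pieces H \<inter> U_v. What links the pieces is that
  the transvections at v, w and v + w of a totally isotropic plane commute: the product of those at
  w and v + w, and the product of all three, lie in U_v, so each piece constrains the other two. The
  four possibilities for one piece come from a product inequality whose thresholds are 4^g - 4 and 2
  (4^g - 4); hence the local analysis runs on the bound idx + 4 < 4^g, and 2 N^- itself is spent at
  the end, on proper subgroups of the stabilizer of a form. The condition g >= 3 is essential:
  Sp_4(2) is the symmetric group S_6, and A_6 has index 2 without stabilizing a form or a vector. It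
  enters through totally isotropic 3-spaces, see \<open>ex_transv_mem\<close>.\<close>

locale symplectic_F2 =
  fixes om :: "'a::{ab_group_add,finite} \<Rightarrow> 'a \<Rightarrow> bool" and g :: nat
  assumes dbl [simp]: "(x :: 'a) + x = 0"
    and om_add [simp]: "om (x + y) z \<longleftrightarrow> om x z \<noteq> om y z"
    and om_sym: "om x y = om y x"
    and om_self [simp]: "\<not> om x x"
    and om_nondegenerate: "(\<And>y. \<not> om x y) \<Longrightarrow> x = 0"
    and card_UNIV: "CARD('a) = 4 ^ g"
    and g_ge_3: "g \<ge> 3"
begin

lemma dbl_left [simp]: "(x :: 'a) + (x + y) = y"
  by (simp add: add.assoc[symmetric])

lemma add_eq_0_iff_eq: "(x :: 'a) + y = 0 \<longleftrightarrow> x = y"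
  by (metis add.right_neutral dbl_left dbl)

lemma om_add_right [simp]: "om z (x + y) \<longleftrightarrow> om z x \<noteq> om z y"
  by (metis om_add om_sym)

lemma om_zero [simp]: "\<not> om 0 x" "\<not> om x 0"
  using om_add[of 0 0 x] om_add_right[of x 0 0] by simp_all

lemma ex_om: "x \<noteq> 0 \<Longrightarrow> \<exists>y. om y x"
  using om_nondegenerate om_sym by blast

lemma om_ext: "(\<And>z. om x z = om y z) \<Longrightarrow> x = y"
  by (metis add_eq_0_iff_eq om_add om_nondegenerate)

section \<open>Subspaces, orthogonal complements and prescribed values of the form\<close>

definition subsp :: "'a set \<Rightarrow> bool" where
  "subsp S \<longleftrightarrow> 0 \<in> S \<and> (\<forall>x\<in>S. \<forall>y\<in>S. x + y \<in> S)"

definition perp :: "'a set \<Rightarrow> 'a set" where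
  "perp S = {x. \<forall>y\<in>S. \<not> om x y}"

lemma subspD: "subsp S \<Longrightarrow> x \<in> S \<Longrightarrow> y \<in> S \<Longrightarrow> x + y \<in> S"
  by (simp add: subsp_def)

lemma subsp_add_iff: "subsp S \<Longrightarrow> x \<in> S \<Longrightarrow> x + y \<in> S \<longleftrightarrow> y \<in> S"
  by (metis subspD dbl_left)

lemma subsp_perp: "subsp (perp S)"
  by (auto simp: subsp_def perp_def)

lemma subsp_UNIV [simp]: "subsp UNIV"
  by (simp add: subsp_def)

lemma subsp_zero_mem: "subsp S \<Longrightarrow> 0 \<in> S"
  by (simp add: subsp_def)

text \<open>Translation by some \<open>a\<close> with \<open>\<phi> a\<close> permutes
  \<open>S\<close> and reverses every sign.\<close>

lemma sum_signs_additive: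
  fixes \<phi> :: "'a \<Rightarrow> bool"
  assumes S: "subsp S" and add: "\<And>x y. x \<in> S \<Longrightarrow> y \<in> S \<Longrightarrow> \<phi> (x + y) \<longleftrightarrow> \<phi> x \<noteq> \<phi> y"
  shows "(\<Sum>x\<in>S. if \<phi> x then -1 else 1 :: int) = (if \<forall>x\<in>S. \<not> \<phi> x then int (card S) else 0)"
proof (cases "\<forall>x\<in>S. \<not> \<phi> x")
  case False
  then obtain a where a: "a \<in> S" "\<phi> a" by blast
  let ?f = "\<lambda>x. if \<phi> x then -1 else 1 :: int"
  have "(\<Sum>x\<in>S. ?f x) = (\<Sum>x\<in>S. ?f (a + x))"
    by (rule sum.reindex_bij_witness[where i="\<lambda>x. a + x" and j="\<lambda>x. a + x"])
      (use a S in \<open>auto simp: subsp_add_iff\<close>)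
  also have "\<dots> = (\<Sum>x\<in>S. - ?f x)"
    by (rule sum.cong) (use a add in auto)
  also have "\<dots> = - (\<Sum>x\<in>S. ?f x)"
    by (rule sum_negf)
  finally have "(\<Sum>x\<in>S. ?f x) = 0"
    by linarith
  then show ?thesis using False by (simp only: if_False)
qed auto

text \<open>Double count of the signs of \<open>om x y\<close> over all x and all y in
  \<open>S\<close>: summing over y first leaves x in \<open>perp S\<close>, summing over x first
  leaves y = 0.\<close>

lemma card_perp:
  assumes S: "subsp S"
  shows "card S * card (perp S) = 4 ^ g"
proof -
  let ?f = "\<lambda>x y. if om x y then -1 else 1 :: int"
  have "(\<Sum>x\<in>UNIV. \<Sum>y\<in>S. ?f x y) = (\<Sum>x\<in>UNIV. if x \<in> perp S then int (card S) else 0)"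
    by (rule sum.cong[OF refl], subst sum_signs_additive[OF S]) (auto simp: perp_def)
  also have "\<dots> = int (card (perp S)) * int (card S)"
    by (simp add: sum.If_cases)
  finally have 1: "(\<Sum>x\<in>UNIV. \<Sum>y\<in>S. ?f x y) = int (card (perp S)) * int (card S)" .
  have "(\<Sum>x\<in>UNIV. ?f x y) = (if y = 0 then 4 ^ g else 0)" for y
    by (subst sum_signs_additive[where \<phi>="\<lambda>x. om x y"]) (use ex_om card_UNIV in auto)
  then have "(\<Sum>y\<in>S. \<Sum>x\<in>UNIV. ?f x y) = (\<Sum>y\<in>S. if y = 0 then 4 ^ g else 0)"
    by simp
  also have "\<dots> = 4 ^ g"
    using subsp_zero_mem[OF S] by (simp add: sum.If_cases)
  finally have "(\<Sum>x\<in>UNIV. \<Sum>y\<in>S. ?f x y) = 4 ^ g"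
    by (subst sum.swap)
  then have "int (card (perp S)) * int (card S) = 4 ^ g"
    using 1 by simp
  then have "int (card S * card (perp S)) = int (4 ^ g)"
    by (simp add: mult.commute)
  then show ?thesis by (simp only: of_nat_eq_iff)
qed

lemma card_subsp_pos: "subsp S \<Longrightarrow> card S > 0"
  using subsp_zero_mem[of S] by (auto simp: card_gt_0_iff)

lemma perp_perp:
  assumes S: "subsp S" shows "perp (perp S) = S"
proof -
  have "card S * card (perp S) = card (perp (perp S)) * card (perp S)"
    using card_perp[OF S] card_perp[OF subsp_perp[of S]] by (metis mult.commute)
  then have "card S = card (perp (perp S))"
    using card_subsp_pos[OF subsp_perp[of S]] by (metis mult_right_cancel less_irrefl)
  moreover have "S \<subseteq> perp (perp S)" by (auto simp: perp_def om_sym)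
  ultimately show ?thesis
    by (metis card_subset_eq finite)
qed

lemma card_subsp_power:
  assumes S: "subsp S" obtains k where "card S = 2 ^ k" "k \<le> 2 * g"
proof -
  have "card S dvd 2 ^ (2 * g)"
    using card_perp[OF S] by (simp add: power_mult) (metis dvd_triv_left)
  then show ?thesis
    using that by (metis divides_primepow_nat two_is_prime_nat)
qed

lemma ex_perp_separating:
  assumes "subsp S" "x \<notin> S"
  shows "\<exists>y \<in> perp S. om y x"
proof (rule ccontr)
  assume "\<not> ?thesis"
  then have "x \<in> perp (perp S)" by (auto simp: perp_def om_sym)
  then show False using perp_perp[OF assms(1)] assms(2) by simp
qed

lemma subsp_plane: "subsp {0, a, b, a + b}"
  by (auto simp: subsp_def ac_simps)

lemma subsp_pair: "subsp {0, a}"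
  by (auto simp: subsp_def ac_simps)

lemma ex_om_value:
  assumes "a \<noteq> 0" shows "\<exists>z. om z a = p"
  using ex_om[OF assms] om_zero(1)[of a] by (cases p) blast+

lemma ex_om_values2:
  assumes "a \<noteq> 0" "b \<noteq> 0" "a \<noteq> b"
  shows "\<exists>z. om z a = p \<and> om z b = q"
proof -
  obtain z1 where z1: "\<not> om z1 a" "om z1 b"
    using ex_perp_separating[OF subsp_pair[of a], of b] assms by (auto simp: perp_def)
  obtain z2 where z2: "\<not> om z2 b" "om z2 a"
    using ex_perp_separating[OF subsp_pair[of b], of a] assms by (auto simp: perp_def)
  show ?thesis
    using z1 z2 by (intro exI[of _ "(if p then z2 else 0) + (if q then z1 else 0)"]) auto
qed

text \<open>The side conditions express linear independence over F_2; \<open>z1\<close> corrects the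
  value at \<open>c\<close> without touching those at \<open>a\<close> and \<open>b\<close>.\<close>

lemma ex_om_values3:
  assumes "a \<noteq> 0" "b \<noteq> 0" "a \<noteq> b" "c \<noteq> 0" "c \<noteq> a" "c \<noteq> b" "c \<noteq> a + b"
  shows "\<exists>z. om z a = p \<and> om z b = q \<and> om z c = r"
proof -
  obtain z1 where z1: "\<not> om z1 a" "\<not> om z1 b" "om z1 c"
    using ex_perp_separating[OF subsp_plane[of a b], of c] assms by (auto simp: perp_def)
  obtain z2 where z2: "om z2 a = p" "om z2 b = q"
    using ex_om_values2 assms by blast
  show ?thesis
    using z1 z2 by (intro exI[of _ "z2 + (if om z2 c = r then 0 else z1)"]) auto
qed

definition Isom :: "('a \<Rightarrow> 'a) set" where
  "Isom = {f. (\<forall>x y. f (x + y) = f x + f y) \<and> (\<forall>x y. om (f x) (f y) = om x y)}"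

section \<open>Transvections and unipotent radicals\<close>

definition transv :: "'a \<Rightarrow> 'a \<Rightarrow> 'a" where
  "transv c x = (if om x c then x + c else x)"

text \<open>For \<^term>\<open>w\<close> orthogonal to \<^term>\<open>v\<close>, the maps \<^term>\<open>unip v w e\<close> form the unipotent radical of the
  stabilizer of \<^term>\<open>v\<close>, an elementary abelian group.\<close>

definition unip :: "'a \<Rightarrow> 'a \<Rightarrow> bool \<Rightarrow> 'a \<Rightarrow> 'a" where
  "unip v w e x = x + (if om x v then w else 0) + (if om x w \<noteq> (e \<and> om x v) then v else 0)"

abbreviation ginv :: "('a \<Rightarrow> 'a) \<Rightarrow> 'a \<Rightarrow> 'a" where
  "ginv f \<equiv> inv_into UNIV f"

lemma Isom_add: "f \<in> Isom \<Longrightarrow> f (x + y) = f x + f y"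
  and Isom_om: "f \<in> Isom \<Longrightarrow> om (f x) (f y) = om x y"
  by (auto simp: Isom_def)

lemma Isom_zero: "f \<in> Isom \<Longrightarrow> f 0 = 0"
  by (metis Isom_add add_cancel_left_left dbl)

lemma Isom_inj: "f \<in> Isom \<Longrightarrow> inj f"
  by (metis Isom_add Isom_om inj_def om_ext)

lemma Isom_eq_iff: "f \<in> Isom \<Longrightarrow> f x = f y \<longleftrightarrow> x = y"
  by (meson Isom_inj injD)

lemma Isom_eq_0_iff: "f \<in> Isom \<Longrightarrow> f x = 0 \<longleftrightarrow> x = 0"
  by (metis Isom_eq_iff Isom_zero)

lemma Isom_bij: "f \<in> Isom \<Longrightarrow> bij f"
  using Isom_inj by (simp add: bij_def finite_UNIV_inj_surj)

lemma Isom_comp [simp]: "f \<in> Isom \<Longrightarrow> h \<in> Isom \<Longrightarrow> f \<circ> h \<in> Isom"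
  by (auto simp: Isom_def)

lemma Isom_id [simp]: "id \<in> Isom"
  by (auto simp: Isom_def)

lemma Isom_inv_f: "f \<in> Isom \<Longrightarrow> ginv f (f x) = x"
  by (simp add: Isom_inj)

lemma Isom_f_inv: "f \<in> Isom \<Longrightarrow> f (ginv f x) = x"
  by (meson Isom_bij bij_inv_eq_iff)

lemma Isom_inv [simp]: "f \<in> Isom \<Longrightarrow> ginv f \<in> Isom"
proof -
  assume f: "f \<in> Isom"
  have "ginv f (x + y) = ginv f x + ginv f y" for x y
    using Isom_add[OF f, of "ginv f x" "ginv f y"] Isom_inv_f[OF f] Isom_f_inv[OF f] by metis
  moreover have "om (ginv f x) (ginv f y) = om x y" for x y
    using Isom_om[OF f, of "ginv f x" "ginv f y"] Isom_f_inv[OF f] by simp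
  ultimately show ?thesis by (auto simp: Isom_def)
qed

lemma Isom_inv_comp: "f \<in> Isom \<Longrightarrow> ginv f \<circ> f = id" "f \<in> Isom \<Longrightarrow> f \<circ> ginv f = id"
  by (auto simp: Isom_inv_f Isom_f_inv)

lemma transv_in_Isom [simp]: "transv c \<in> Isom"
  by (auto simp: Isom_def transv_def ac_simps om_sym)

lemma transv_transv [simp]: "transv c (transv c x) = x"
  by (auto simp: transv_def ac_simps)

lemma transv_comp_transv [simp]: "transv c \<circ> transv c = id"
  by auto

lemma unip_in_Isom [simp]: "\<not> om v w \<Longrightarrow> unip v w e \<in> Isom"
  by (auto simp: Isom_def unip_def ac_simps om_sym)

lemma unip_comp:
  "\<not> om v w \<Longrightarrow> \<not> om v w' \<Longrightarrow> unip v w e \<circ> unip v w' e' = unip v (w + w') ((e \<noteq> e') \<noteq> om w w')"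
  by (rule ext) (auto simp: unip_def ac_simps om_sym)

lemma unip_zero: "unip v 0 True = transv v" "unip v 0 False = id"
  by (auto simp: unip_def transv_def fun_eq_iff ac_simps)

lemma unip_self: "unip v v True = transv v" "unip v v False = id"
  by (auto simp: unip_def transv_def fun_eq_iff ac_simps)

lemma unip_swap: "\<not> om v w \<Longrightarrow> unip v w False = unip w v False"
  by (auto simp: unip_def fun_eq_iff ac_simps)

lemma unip_add_v: "\<not> om v w \<Longrightarrow> unip v (w + v) e = unip v w e" "\<not> om v w \<Longrightarrow> unip v (v + w) e = unip v w e"
  by (auto simp: unip_def fun_eq_iff ac_simps)

text \<open>The key to all arguments on planes: for orthogonal v and w, \<open>unip v w True\<close>
  is the product of the transvections at w and v + w, and by the next lemma
  \<open>unip v w False\<close> is the product of all three transvections of the plane, hence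
  symmetric in v and w.\<close>

lemma unip_True: "\<not> om v w \<Longrightarrow> unip v w True = transv w \<circ> transv (v + w)"
  by (auto simp: unip_def transv_def fun_eq_iff ac_simps om_sym)

lemma unip_False: "\<not> om v w \<Longrightarrow> unip v w False = transv v \<circ> unip v w True"
  by (auto simp: unip_def transv_def fun_eq_iff ac_simps om_sym)

lemma unip_inv: "\<not> om v w \<Longrightarrow> unip v w e (unip v w e x) = x"
  by (auto simp: unip_def ac_simps om_sym)

lemma unip_conj: "f \<in> Isom \<Longrightarrow> f \<circ> unip v w e = unip (f v) (f w) e \<circ> f"
  by (auto simp: unip_def fun_eq_iff Isom_add Isom_om Isom_zero)

lemma transv_conj: "f \<in> Isom \<Longrightarrow> f \<circ> transv v = transv (f v) \<circ> f"
  by (auto simp: transv_def fun_eq_iff Isom_add Isom_om)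

end

section \<open>Subgroups of the symplectic group and their intersections with unipotent
  radicals\<close>

locale symplectic_F2_subgroup = symplectic_F2 om g
  for om :: "'a::{ab_group_add,finite} \<Rightarrow> 'a \<Rightarrow> bool" and g +
  fixes H :: "('a \<Rightarrow> 'a) set"
  assumes H_sub_Isom: "H \<subseteq> Isom"
    and H_id: "id \<in> H"
    and H_comp: "f \<in> H \<Longrightarrow> h \<in> H \<Longrightarrow> f \<circ> h \<in> H"
    and H_ginv: "f \<in> H \<Longrightarrow> ginv f \<in> H"
begin

lemma H_Isom: "f \<in> H \<Longrightarrow> f \<in> Isom"
  using H_sub_Isom by blast

lemma H_comp_left: "f \<in> H \<Longrightarrow> f \<circ> h \<in> H \<longleftrightarrow> h \<in> H"
  by (metis H_Isom H_comp H_ginv Isom_inv_comp(1) comp_assoc id_comp)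

lemma H_comp_right: "f \<in> H \<Longrightarrow> h \<circ> f \<in> H \<longleftrightarrow> h \<in> H"
  by (metis H_Isom H_comp H_ginv Isom_inv_comp(2) comp_assoc comp_id)

lemma H_conj: "f \<in> H \<Longrightarrow> k \<circ> f = f \<circ> h \<Longrightarrow> k \<in> H \<longleftrightarrow> h \<in> H"
  by (metis H_comp_left H_comp_right)

lemma transv_image_iff: "f \<in> H \<Longrightarrow> transv (f v) \<in> H \<longleftrightarrow> transv v \<in> H"
  by (rule H_conj[of f]) (simp_all add: transv_conj H_Isom)

lemma unip_image_iff: "f \<in> H \<Longrightarrow> unip (f v) (f w) e \<in> H \<longleftrightarrow> unip v w e \<in> H"
  by (rule H_conj[of f]) (simp_all add: unip_conj H_Isom)

text \<open>Conjugation by \<open>transv a\<close> turns \<open>transv b\<close> into the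
  transvection at the image a + b of b.\<close>

lemma transv_closed:
  assumes "transv a \<in> H" "transv b \<in> H" "om a b" shows "transv (a + b) \<in> H"
  using transv_image_iff[OF assms(1), of b] assms(2,3) by (simp add: transv_def om_sym ac_simps)

lemma unip_comp_mem:
  assumes "\<not> om v w" "\<not> om v w'" "unip v w e \<in> H" "unip v w' e' \<in> H"
  shows "unip v (w + w') ((e \<noteq> e') \<noteq> om w w') \<in> H"
  using unip_comp[OF assms(1,2), of e e'] H_comp[OF assms(3,4)] by simp

context
  fixes v w assumes vw: "\<not> om v w"
begin

lemma unip_False_iff_unip_True: "transv v \<in> H \<Longrightarrow> unip v w False \<in> H \<longleftrightarrow> unip v w True \<in> H"
  using unip_False[OF vw] H_comp_left by simp

lemma transv_iff_unip_True_of_False: "unip v w False \<in> H \<Longrightarrow> transv v \<in> H \<longleftrightarrow> unip v w True \<in> H"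
  using unip_False[OF vw] H_comp_left H_comp_right by metis

lemma unip_both_imp_transv: "unip v w False \<in> H \<Longrightarrow> unip v w True \<in> H \<Longrightarrow> transv v \<in> H"
  by (simp add: transv_iff_unip_True_of_False)

lemma unip_True_transv_iff: "unip v w True \<in> H \<Longrightarrow> transv w \<in> H \<longleftrightarrow> transv (v + w) \<in> H"
  using unip_True[OF vw] H_comp_left H_comp_right by metis

lemma transv_iff_unip_True: "transv w \<in> H \<Longrightarrow> transv (v + w) \<in> H \<longleftrightarrow> unip v w True \<in> H"
  using unip_True[OF vw] H_comp_left by simp

end

lemma unip_True_third:
  assumes "\<not> om v w" "unip v w True \<in> H" "unip w v True \<in> H"
  shows "unip (v + w) v True \<in> H"
proof -
  have "unip (v + w) v True = unip v w True \<circ> unip w v True"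
    using assms(1) by (auto simp: unip_def fun_eq_iff ac_simps om_sym)
  then show ?thesis using H_comp[OF assms(2,3)] by simp
qed

text \<open>The four possibilities for the intersection of \<^term>\<open>H\<close> with the unipotent radical \<open>U\<close> at
  \<^term>\<open>v\<close>: it contains \<^term>\<open>transv v\<close> and has index at most 2 in \<open>U\<close> (\<open>isF\<close>), it is generated by
  \<^term>\<open>transv v\<close> (\<open>isN\<close>), it is a complement of \<^term>\<open>transv v\<close> in \<open>U\<close> (\<open>isM\<close>), or it is trivial (\<open>isR\<close>).\<close>

definition isF :: "'a \<Rightarrow> bool" where
  "isF v \<longleftrightarrow> transv v \<in> H \<and> (\<exists>y. \<not> om v y \<and> (\<forall>w. \<not> om v w \<longrightarrow> (unip v w False \<in> H \<longleftrightarrow> \<not> om w y)))"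

definition isN :: "'a \<Rightarrow> bool" where
  "isN v \<longleftrightarrow> transv v \<in> H \<and> (\<forall>w. \<not> om v w \<longrightarrow> w \<noteq> 0 \<longrightarrow> w \<noteq> v \<longrightarrow> unip v w False \<notin> H)"

definition isM :: "'a \<Rightarrow> bool" where
  "isM v \<longleftrightarrow> transv v \<notin> H \<and> (\<forall>w. \<not> om v w \<longrightarrow> unip v w False \<in> H \<or> unip v w True \<in> H)"

definition isR :: "'a \<Rightarrow> bool" where
  "isR v \<longleftrightarrow> transv v \<notin> H \<and> (\<forall>w e. \<not> om v w \<longrightarrow> w \<noteq> 0 \<longrightarrow> w \<noteq> v \<longrightarrow> unip v w e \<notin> H)"

lemma isR_image:
  assumes f: "f \<in> H" and v: "isR v" shows "isR (f v)"
  unfolding isR_def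
proof (intro conjI allI impI)
  show "transv (f v) \<notin> H" using v transv_image_iff[OF f] by (simp add: isR_def)
  fix w e assume w: "\<not> om (f v) w" "w \<noteq> 0" "w \<noteq> f v"
  have Isom: "f \<in> Isom" using f H_Isom by blast
  obtain w' where w': "w = f w'" using Isom_f_inv[OF Isom] by metis
  show "unip (f v) w e \<notin> H"
    using v w unfolding w' isR_def unip_image_iff[OF f] by (auto simp: Isom_om[OF Isom] Isom_eq_iff[OF Isom] Isom_eq_0_iff[OF Isom])
qed

text \<open>If \<open>H\<close> meets the unipotent radical at \<open>v\<close> trivially, then \<open>ext\<close> makes its stabilizer of \<open>v\<close>
  a complement of the radical. The element of \<open>H\<close> over the transvection at \<open>a\<close> must commute with the
  elements of \<open>H\<close> over the centralizer of that transvection, which confines its radical part to the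
  plane spanned by \<open>a\<close> and \<open>v\<close>.\<close>

lemma R_mem_cases:
  assumes v: "v \<noteq> 0" "isR v" and a: "\<not> om v a" "a \<noteq> 0" "a \<noteq> v"
    and ext: "\<And>f. f \<in> Isom \<Longrightarrow> f v = v \<Longrightarrow> \<exists>w e. \<not> om v w \<and> f \<circ> unip v w e \<in> H"
  shows "transv a \<in> H \<or> transv (v + a) \<in> H \<or> unip (v + a) v True \<in> H \<or> unip a v True \<in> H"
proof -
  have R: "\<And>w e. \<not> om v w \<Longrightarrow> unip v w e \<in> H \<Longrightarrow> w = 0 \<or> w = v" "transv v \<notin> H"
    using v unfolding isR_def by auto
  obtain w e where w: "\<not> om v w" "transv a \<circ> unip v w e \<in> H"
    using ext[of "transv a"] a by (auto simp: transv_def)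
  define h where "h = transv a \<circ> unip v w e"
  have h: "h \<in> H" using w h_def by simp
  \<comment> \<open>Otherwise the transvection cancels in the square of \<open>h\<close>, which is
    then a nontrivial element of the radical.\<close>
  have aw: "\<not> om a w"
  proof
    assume "om a w"
    then have "h \<circ> h = unip v a True"
      using w a by (auto simp: h_def transv_def unip_def fun_eq_iff ac_simps om_sym)
    then show False using R(1)[OF a(1)] a H_comp[OF h h] by metis
  qed
  have "w \<in> {0, a, v, a + v}"
  proof (rule ccontr)
    assume n: "w \<notin> {0, a, v, a + v}"
    \<comment> \<open>The transvection at \<open>c\<close> commutes with that at \<open>a\<close>
      but moves \<open>w\<close>. So \<open>h\<close> and its conjugate under an element
      \<open>k\<close> of H over \<open>transv c\<close> differ by a radical element with parameter
      \<open>b\<close>, equal to \<open>c\<close> or \<open>c + a\<close>. It cannot be 0 or v,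
      because \<open>om b w\<close>.\<close>
    obtain c where c: "\<not> om c v" "\<not> om c a" "om c w"
      using ex_om_values3[of v a w False False True] n v a by (auto simp: add.commute)
    obtain w' e' where w': "\<not> om v w'" "transv c \<circ> unip v w' e' \<in> H"
      using ext[of "transv c"] c by (auto simp: transv_def om_sym)
    define k where "k = transv c \<circ> unip v w' e'"
    have k: "k \<in> H" using w' k_def by simp
    define b where "b = (if om a w' then c + a else c)"
    have kG: "k \<in> Isom" using k H_Isom by blast
    have kv: "k v = v" using c w' by (simp add: k_def unip_def transv_def om_sym)
    define m where "m \<longleftrightarrow> om a w'"
    have ka: "k a = (if m then v + a else a)"
      using c w' a by (auto simp: k_def unip_def transv_def m_def om_sym ac_simps)
    define kw where "kw = k w"
    have kw: "kw = w + c \<or> kw = v + (w + c)"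
      using c w' w by (auto simp: kw_def k_def unip_def transv_def om_sym ac_simps)
    have ukw: "unip v kw e = unip v (w + c) e"
      using kw w c unip_add_v(2)[of v "w + c" e] by (auto simp: om_sym)
    have "k \<circ> h = transv (k a) \<circ> unip v kw e \<circ> k"
      unfolding h_def kw_def by (metis comp_assoc transv_conj[OF kG] unip_conj[OF kG] kv)
    then have "h \<circ> k \<circ> h = transv a \<circ> unip v w e \<circ> transv (k a) \<circ> unip v (w + c) e \<circ> k"
      unfolding ukw by (simp add: h_def comp_assoc)
    moreover have "transv a \<circ> unip v w e = unip v w e \<circ> transv a"
      using aw a unip_conj[of "transv a" v w e] by (simp add: transv_def om_sym)
    ultimately have "h \<circ> k \<circ> h = unip v w e \<circ> (transv a \<circ> transv (k a)) \<circ> unip v (w + c) e \<circ> k"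
      by (simp add: comp_assoc)
    moreover have "transv a \<circ> transv (k a) = (if m then unip v a True else id)"
      using unip_True[OF a(1)] by (simp add: ka)
    ultimately have "h \<circ> k \<circ> h = unip v w e \<circ> (if m then unip v a True else unip v 0 False) \<circ> unip v (w + c) e \<circ> k"
      by (simp only: unip_zero)
    then have "\<exists>e'. h \<circ> k \<circ> h = unip v (w + (if m then a else 0) + (w + c)) e' \<circ> k"
      using w a c by (auto simp: unip_comp om_sym)
    then obtain e'' where eq: "h \<circ> k \<circ> h = unip v b e'' \<circ> k"
      by (auto simp: b_def m_def ac_simps split: if_splits)
    have "h \<circ> k \<circ> h \<in> H" using h k H_comp by blast
    then have "\<exists>e. unip v b e \<in> H" using eq H_comp_right[OF k] by metis
    moreover have "\<not> om v b" using c a by (auto simp: b_def om_sym)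
    ultimately have "b = 0 \<or> b = v" using R(1) by blast
    then have "om b w = om v w \<or> \<not> om b w" by auto
    moreover have "om b w" using c aw by (auto simp: b_def)
    ultimately show False using w by simp
  qed
  \<comment> \<open>Now \<open>h\<close> is a product of transvections of the plane; the eight
    candidates multiply out to the four elements of the conclusion.\<close>
  moreover have "transv a \<circ> unip v 0 e \<in> {transv a, unip (v + a) v True}"
    using a by (cases e) (auto simp: unip_def transv_def fun_eq_iff ac_simps om_sym)
  moreover have "transv a \<circ> unip v v e \<in> {transv a, unip (v + a) v True}"
    using a by (cases e) (auto simp: unip_def transv_def fun_eq_iff ac_simps om_sym)
  moreover have "transv a \<circ> unip v a e \<in> {transv (v + a), unip a v True}"
    using a by (cases e) (auto simp: unip_def transv_def fun_eq_iff ac_simps om_sym)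
  moreover have "transv a \<circ> unip v (a + v) e \<in> {transv (v + a), unip a v True}"
    using a by (cases e) (auto simp: unip_def transv_def fun_eq_iff ac_simps om_sym)
  ultimately show ?thesis
    using h unfolding h_def by auto
qed

end

section \<open>How the types of the vectors in a totally isotropic plane fit together\<close>

context symplectic_F2_subgroup
begin

context
  assumes types: "\<And>v. v \<noteq> 0 \<Longrightarrow> isF v \<or> isN v \<or> isM v \<or> isR v"
begin

text \<open>With \<open>transv a\<close> in H, any of the elements required by the types F, N or M
  at v + a would yield a nontrivial element of H in the radical at v.\<close>

lemma R_plane1:
  assumes v: "isR v" and a: "\<not> om v a" "a \<noteq> 0" "a \<noteq> v" and Ta: "transv a \<in> H"
  shows "isR (v + a) \<and> \<not> isR a"
proof -
  have R: "\<And>e. unip v a e \<notin> H" "transv v \<notin> H" using v a by (auto simp: isR_def)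
  have b: "v + a \<noteq> 0" "\<not> om (v + a) v" using a by (auto simp: add_eq_0_iff_eq om_sym)
  have Tb: "transv (v + a) \<notin> H" using R transv_iff_unip_True[OF a(1) Ta] by blast
  have "unip (v + a) v False \<notin> H"
    using unip_swap[of "v + a" v] unip_add_v[of v a] R b a by (simp add: om_sym)
  moreover have "unip (v + a) v True \<notin> H"
    using unip_True_transv_iff[of "v + a" v] b Ta R by (auto simp: ac_simps)
  ultimately have "\<not> isM (v + a)" using b unfolding isM_def by blast
  moreover have "\<not> isF (v + a)" "\<not> isN (v + a)" using Tb by (auto simp: isF_def isN_def)
  ultimately show ?thesis using types[OF b(1)] Ta by (auto simp: isR_def)
qed

text \<open>Here H contains the product of the transvections at v and a but neither factor. Type M
  at a would supply the product of all three transvections or that of those at v and v + a, and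
  either leads to a nontrivial element of H in the radical at v.\<close>

lemma R_plane2:
  assumes v: "v \<noteq> 0" "isR v" and a: "\<not> om v a" "a \<noteq> 0" "a \<noteq> v" and m: "unip (v + a) v True \<in> H"
  shows "isR a \<and> \<not> isR (v + a)"
proof -
  have R: "\<And>e. unip v a e \<notin> H" "transv v \<notin> H" using v a by (auto simp: isR_def)
  have b: "\<not> om (v + a) v" "\<not> om (v + a) a" "\<not> om a v" using a by (auto simp: om_sym)
  have "v \<noteq> v + a" using a by simp
  then have nb: "\<not> isR (v + a)" using m b(1) v(1) unfolding isR_def by blast
  have Ta: "transv a \<notin> H" using unip_True_transv_iff[OF b(1) m] R by (simp add: ac_simps)
  have "unip a v False \<notin> H" using R unip_swap[of a v] b by simp
  moreover have "unip a v True \<notin> H"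
  proof
    assume "unip a v True \<in> H"
    then have 1: "unip a (v + a) True \<in> H" using b by (simp add: unip_add_v)
    have 2: "unip (v + a) a True \<in> H"
      using unip_add_v(1)[of "v + a" a True] m b by (simp add: ac_simps)
    show False
      using unip_True_third[OF b(2) 2 1] R a by (simp add: ac_simps unip_add_v)
  qed
  ultimately have "\<not> isM a" using b unfolding isM_def by blast
  then show ?thesis using types[OF a(2)] Ta nb by (auto simp: isF_def isN_def)
qed

text \<open>The four cases of \<open>R_mem_cases\<close> are those of the two preceding lemmas, each
  applied to a and to v + a.\<close>

lemma R_plane:
  assumes v: "v \<noteq> 0" "isR v" and a: "\<not> om v a" "a \<noteq> 0" "a \<noteq> v"
    and ext: "\<And>f. f \<in> Isom \<Longrightarrow> f v = v \<Longrightarrow> \<exists>w e. \<not> om v w \<and> f \<circ> unip v w e \<in> H"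
  shows "isR a \<noteq> isR (v + a)"
proof -
  have b: "\<not> om v (v + a)" "v + a \<noteq> 0" "v + a \<noteq> v" using a by (auto simp: add_eq_0_iff_eq)
  show ?thesis
    using R_mem_cases[OF v a ext] R_plane1[OF v(2) a] R_plane1[OF v(2) b]
      R_plane2[OF v a] R_plane2[OF v b] by auto
qed

context
  assumes noR: "\<And>v. v \<noteq> 0 \<Longrightarrow> \<not> isR v"
begin

text \<open>Both transvections together would produce \<open>unip v w True\<close>, against type N
  at v. If \<open>transv w\<close> is missing, w has type M and supplies the product of the
  transvections at v and v + w, of which the first is in H.\<close>

lemma N_plane:
  assumes noF: "\<And>v. v \<noteq> 0 \<Longrightarrow> \<not> isF v"
    and v: "v \<noteq> 0" "transv v \<in> H" and w: "\<not> om v w" "w \<noteq> 0" "w \<noteq> v"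
  shows "transv w \<in> H \<longleftrightarrow> transv (v + w) \<notin> H"
proof -
  have N: "isN v" using types[OF v(1)] noR noF v by (auto simp: isM_def)
  then have s: "unip v w False \<notin> H" using w by (auto simp: isN_def)
  then have s1: "unip v w True \<notin> H" using unip_False_iff_unip_True[OF w(1) v(2)] by simp
  have sw: "unip w v False \<notin> H" using s unip_swap[OF w(1)] by simp
  have "transv (v + w) \<in> H" if "transv w \<notin> H"
  proof -
    have "isM w" using types[OF w(2)] noR w that noF by (auto simp: isN_def)
    then have "unip w v True \<in> H" using sw w by (auto simp: isM_def om_sym)
    then show ?thesis using unip_True_transv_iff[of w v] v w by (auto simp: om_sym ac_simps)
  qed
  then show ?thesis using s1 transv_iff_unip_True[OF w(1)] by blast
qed

text \<open>The seven transvections of a totally isotropic 3-space multiply to the identity. Hence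
  if H contains the products of two of them, it contains a single one as well, and there is no
  parity obstruction. Such a 3-space exists only for g >= 3; for g = 2 the group A_6 contains no
  transvection.\<close>

lemma ex_transv_mem: "\<exists>v. v \<noteq> 0 \<and> transv v \<in> H"
proof (rule ccontr)
  assume "\<not> ?thesis"
  then have D: "\<And>v. v \<noteq> 0 \<Longrightarrow> transv v \<notin> H" by blast
  then have M: "\<And>v w. v \<noteq> 0 \<Longrightarrow> \<not> om v w \<Longrightarrow> unip v w False \<in> H \<or> unip v w True \<in> H"
    using types noR by (auto simp: isF_def isN_def isM_def)
  have excl: "\<not> (unip v w False \<in> H \<and> unip v w True \<in> H)" if "v \<noteq> 0" "\<not> om v w" for v w
    using unip_both_imp_transv[OF that(2)] D[OF that(1)] by blast
  have big: "4 < CARD('a)"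
    using card_UNIV g_ge_3 power_increasing[of 3 g "4::nat"] by simp
  obtain v :: 'a where v: "v \<noteq> 0"
  proof -
    have "(UNIV :: 'a set) \<noteq> {0}"
    proof
      assume "(UNIV :: 'a set) = {0}"
      then have "CARD('a) = card {0 :: 'a}" by (simp only:)
      then show False using big by simp
    qed
    then show thesis using that by blast
  qed
  obtain c where c: "\<not> om c v" "c \<noteq> 0" "c \<noteq> v"
  proof -
    have "perp {0, v} \<noteq> {0, v}"
    proof
      assume "perp {0,v} = {0,v}"
      then have "card {0,v} * card {0,v} = 4 ^ g" using card_perp[OF subsp_pair[of v]] by simp
      then show False using big card_UNIV v by simp
    qed
    moreover have "{0, v} \<subseteq> perp {0, v}" by (auto simp: perp_def)
    ultimately show thesis using that by (auto simp: perp_def)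
  qed
  obtain c' where c': "\<not> om c' v" "om c' c" using ex_om_values2[of v c False True] v c by auto
  \<comment> \<open>Composing the elements for two nonorthogonal vectors switches the last parameter
    to \<open>True\<close>, so the parameter cannot be \<open>False\<close> throughout.\<close>
  have "\<exists>w. \<not> om v w \<and> unip v w False \<notin> H"
  proof (rule ccontr)
    assume "\<not> ?thesis"
    then have all: "\<And>w. \<not> om v w \<Longrightarrow> unip v w False \<in> H" by blast
    have o: "\<not> om v c" "\<not> om v c'" "om c c'" "\<not> om v (c + c')"
      using c c' om_sym[of v c] om_sym[of v c'] om_sym[of c c'] by auto
    have "unip v (c + c') True \<in> H"
      using unip_comp_mem[OF o(1,2) all[OF o(1)] all[OF o(2)]] o(3) by simp
    then show False using excl[OF v o(4)] all[OF o(4)] by blast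
  qed
  then obtain w where w: "\<not> om v w" "unip v w False \<notin> H" by blast
  have w0: "w \<noteq> 0" "w \<noteq> v" using w H_id by (auto simp: unip_zero unip_self)
  obtain x where x: "\<not> om v x" "\<not> om w x" "x \<noteq> 0" "x \<noteq> v" "x \<noteq> w" "x \<noteq> v + w"
  proof -
    have 4: "card {0, v, w, v + w} = 4" using v w0 by (auto simp: add_eq_0_iff_eq)
    have "perp {0, v, w, v + w} \<noteq> {0, v, w, v + w}"
    proof
      assume "perp {0, v, w, v + w} = {0, v, w, v + w}"
      then have "4 * 4 = (4::nat) ^ g" using card_perp[OF subsp_plane[of v w]] 4 by simp
      then have "(4::nat) ^ 2 = 4 ^ g" by simp
      then show False using g_ge_3 by (simp only: power_inject_exp)
    qed
    moreover have "{0, v, w, v + w} \<subseteq> perp {0, v, w, v + w}" using w by (auto simp: perp_def om_sym)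
    ultimately show thesis using that by (auto simp: perp_def om_sym)
  qed
  \<comment> \<open>Adding \<open>w\<close> switches the parameter of \<open>x\<close> from
    \<open>False\<close> to \<open>True\<close> if necessary; so all pairwise products in the planes
    of v, w and of v, w' lie in H.\<close>
  define w' where "w' = (if unip v x False \<in> H then x + w else x)"
  have w': "\<not> om v w'" "\<not> om w w'" "w' \<noteq> 0" "w' \<noteq> v" "w' \<noteq> w" "w' \<noteq> v + w"
    using x w by (auto simp: w'_def add_eq_0_iff_eq)
  have s1: "unip v w True \<in> H" using M[OF v w(1)] w by blast
  have s2: "unip v w' True \<in> H"
  proof (cases "unip v x False \<in> H")
    case True
    then show ?thesis using unip_comp_mem[OF x(1) w(1) True s1] x by (simp add: w'_def om_sym)
  qed (use M[OF v x(1)] in \<open>simp add: w'_def\<close>)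
  have s1': "unip v w False \<notin> H" "unip v w' False \<notin> H" using excl[OF v] s1 s2 w w' by auto
  have t1: "unip w v True \<in> H"
    using M[OF w0(1), of v] s1' unip_swap[OF w(1)] w by (auto simp: om_sym)
  have t2: "unip w' v True \<in> H"
    using M[OF w'(3), of v] s1' unip_swap[OF w'(1)] w' by (auto simp: om_sym)
  have vw: "unip (v + w) v True \<in> H" using unip_True_third[OF w(1) s1 t1] .
  have vw': "unip (v + w') v True \<in> H" using unip_True_third[OF w'(1) s2 t2] .
  have ww': "unip (w + w') w True \<in> H"
  proof -
    have "unip (v + w) v True = transv v \<circ> transv w" "unip (v + w') v True = transv v \<circ> transv w'"
      using unip_True[of "v + w" v] unip_True[of "v + w'" v] w w' by (auto simp: om_sym ac_simps)
    moreover have "transv v \<circ> transv w = transv w \<circ> transv v" using transv_conj[of "transv v" w] w by (auto simp: transv_def om_sym)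
    ultimately have "unip (v + w) v True \<circ> unip (v + w') v True = transv w \<circ> transv w'"
      by (metis transv_comp_transv comp_assoc comp_id)
    moreover have "unip (w + w') w True = transv w \<circ> transv w'"
      using unip_True[of "w + w'" w] w w' by (auto simp: om_sym ac_simps)
    ultimately show ?thesis using H_comp[OF vw vw'] by simp
  qed
  have TT: "unip (w + w') w True = transv w \<circ> transv w'"
    using unip_True[of "w + w'" w] w w' by (auto simp: om_sym ac_simps)
  have "unip w w' False \<notin> H"
  proof
    assume "unip w w' False \<in> H"
    moreover have "unip w w' False = (transv w \<circ> transv w') \<circ> transv (w + w')"
      using unip_False[OF w'(2)] unip_True[OF w'(2)] by (simp add: comp_assoc)
    ultimately have "transv (w + w') \<in> H" using ww' TT H_comp_left by metis
    then show False using D[of "w + w'"] w' by (auto simp: add_eq_0_iff_eq)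
  qed
  then have "unip w w' True \<in> H" using M[OF w0(1) w'(2)] by blast
  \<comment> \<open>This composition is the relation between the seven transvections: four of them
    on one side, those at w, v + w' and v + w + w' on the other.\<close>
  then have "unip w (v + w') False \<in> H"
    using unip_comp_mem[of w v w' True True] t1 w w' by (auto simp: om_sym)
  moreover have "unip w (v + w') False = (transv w \<circ> transv (v + w')) \<circ> transv (w + (v + w'))"
    using unip_False[of w "v + w'"] unip_True[of w "v + w'"] w w' by (simp add: comp_assoc om_sym)
  moreover have "transv w \<circ> transv (v + w') \<in> H"
  proof -
    have "unip v w' True = transv w' \<circ> transv (v + w')" by (rule unip_True[OF w'(1)])
    then have "(transv w \<circ> transv w') \<circ> unip v w' True = transv w \<circ> transv (v + w')"
      by (metis transv_comp_transv comp_assoc comp_id)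
    then show ?thesis using H_comp ww' TT s2 by metis
  qed
  ultimately have "transv (w + (v + w')) \<in> H" using H_comp_left by metis
  moreover have "w + (v + w') \<noteq> 0" using w' by (metis add.assoc add.commute add_eq_0_iff_eq)
  ultimately show False using D by blast
qed

end
end
end

section \<open>Linear functionals, quadratic forms and functions additive on orthogonal
  pairs\<close>

context symplectic_F2
begin

lemma ex_perp:
  assumes "subsp S" "card S \<le> 8"
  shows "\<exists>x\<in>perp S. x \<noteq> 0 \<and> x \<noteq> e"
proof (rule ccontr)
  assume "\<not> ?thesis"
  then have "perp S \<subseteq> {0, e}" by blast
  then have "card (perp S) \<le> card {0, e}" by (rule card_mono[rotated]) simp
  also have "\<dots> \<le> 2" by (simp add: card_insert_if)
  finally have "card S * card (perp S) \<le> 8 * 2" using assms by (intro mult_mono) auto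
  moreover have "(4::nat) ^ 3 \<le> 4 ^ g" using g_ge_3 by (intro power_increasing) auto
  ultimately show False using card_perp[OF assms(1)] by simp
qed

lemma subsp_extend:
  assumes "subsp S" shows "subsp (S \<union> (+) c ` S)"
proof -
  have "x + y \<in> S \<union> (+) c ` S" if "x \<in> S \<union> (+) c ` S" "y \<in> S \<union> (+) c ` S" for x y
  proof -
    have *: "x + y \<in> S" if "x \<in> S" "y \<in> S" for x y using subspD[OF assms that] .
    from that show ?thesis by (force simp: ac_simps intro: *)
  qed
  then show ?thesis using assms by (auto simp: subsp_def)
qed

lemma card_extend: "card ((S :: 'a set) \<union> (+) c ` S) \<le> 2 * card S"
  using card_Un_le[of S "(+) c ` S"] card_image_le[of S "(+) c"] by simp

text \<open>A nonzero vector orthogonal to the kernel represents the functional; over F_2 there is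
  no scalar left to adjust.\<close>

lemma functional_rep:
  assumes add: "\<And>x y. \<phi> (x + y) \<longleftrightarrow> \<phi> x \<noteq> \<phi> y"
  shows "\<exists>z. \<forall>x. \<phi> x \<longleftrightarrow> om x z"
proof (cases "\<exists>a. \<phi> a")
  case True
  then obtain a where a: "\<phi> a" by blast
  define K where "K = {x. \<not> \<phi> x}"
  have K: "subsp K" using add[of 0 0] add by (auto simp: subsp_def K_def)
  have "perp K \<noteq> {0}"
  proof
    assume "perp K = {0}"
    then have "perp (perp K) = UNIV" by (auto simp: perp_def)
    then show False using perp_perp[OF K] a by (auto simp: K_def)
  qed
  then obtain z where z: "z \<in> perp K" "z \<noteq> 0"
    using subsp_zero_mem[OF subsp_perp[of K]] by blast
  have zK: "\<not> om x z" if "\<not> \<phi> x" for x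
    using z that by (auto simp: perp_def K_def om_sym)
  have za: "om x z = om a z" if "\<phi> x" for x
    using zK[of "x + a"] add[of x a] a that by auto
  obtain y where "om y z" using ex_om[OF z(2)] by blast
  then have "om a z" using za zK by blast
  then show ?thesis using za zK by blast
qed (use om_zero in blast)

text \<open>A quadratic form polarizing to \<open>om\<close>. Homogeneity comes for free, because
  the only scalars are 0 and 1.\<close>

definition quad :: "('a \<Rightarrow> bool) \<Rightarrow> bool" where
  "quad q \<longleftrightarrow> (\<forall>x y. q (x + y) \<longleftrightarrow> (q x \<noteq> q y) \<noteq> om x y)"

text \<open>The defect of additivity \<open>F\<close> is a symmetric cocycle that vanishes on
  orthogonal pairs. The cocycle identity makes it constant on nonorthogonal pairs, so it is
  \<open>om\<close> or zero.\<close>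

lemma additive_on_orthogonal_pairs:
  assumes orth: "\<And>x y. \<not> om x y \<Longrightarrow> q (x + y) \<longleftrightarrow> q x \<noteq> q y"
  shows "quad q \<or> (\<forall>x y. q (x + y) \<longleftrightarrow> q x \<noteq> q y)"
proof -
  define F where "F x y \<longleftrightarrow> (q (x + y) \<noteq> (q x \<noteq> q y))" for x y
  have F0: "\<not> F x y" if "\<not> om x y" for x y using orth[OF that] by (simp add: F_def)
  have Fs: "F x y = F y x" for x y by (auto simp: F_def add.commute)
  have coc: "(F x y \<noteq> F (x + y) z) = (F y z \<noteq> F x (y + z))" for x y z
    by (auto simp: F_def add.assoc)
  have 1: "F x y = F x y'" if "om x y" "om x y'" "\<not> om y y'" for x y y'
    using coc[of x y "y + y'"] F0[of "x + y" "y + y'"] F0[of y "y + y'"] that by auto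
  have 2: "F x y = F x y'" if "om x y" "om x y'" for x y y'
  proof (cases "om y y'")
    case True
    show ?thesis
    proof (cases "y' = x + y")
      \<comment> \<open>The one case in which the values at x, y and y' are dependent and no
        connecting vector exists.\<close>
      case True
      then show ?thesis by (auto simp: F_def)
    next
      case False
      have "\<exists>y''. om y'' x = True \<and> om y'' y = False \<and> om y'' y' = False"
        using that True False by (intro ex_om_values3) auto
      then obtain y'' where "om x y''" "\<not> om y'' y" "\<not> om y'' y'" using om_sym by blast
      then show ?thesis using 1[of x y'' y] 1[of x y'' y'] that by simp
    qed
  qed (use 1 that in blast)
  have 3: "F x y = F x' y'" if "om x y" "om x' y'" for x y x' y'
  proof -
    have "x \<noteq> 0" "x' \<noteq> 0" using that by auto
    then obtain z where z: "om z x" "om z x'" using ex_om_value[of x True] ex_om_values2[of x x' True True] by metis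
    then have "F x y = F x z" "F x' y' = F x' z" using 2 that om_sym by blast+
    then show ?thesis using 2[OF z] Fs by metis
  qed
  show ?thesis
  proof (cases "\<exists>x y. om x y \<and> F x y")
    case True
    then have "F x y = om x y" for x y using 3 F0 by blast
    then show ?thesis by (auto simp: quad_def F_def)
  next
    case False
    then have "\<not> F x y" for x y using F0 by blast
    then show ?thesis by (auto simp: F_def)
  qed
qed

end

section \<open>From invariant sets to invariant forms; generation by transvections\<close>

context symplectic_F2_subgroup
begin

lemma invariant_form_or_vector:
  assumes S0: "0 \<notin> S" "S \<noteq> {}"
    and inv: "\<And>f x. f \<in> H \<Longrightarrow> x \<in> S \<Longrightarrow> f x \<in> S"
    and plane: "\<And>v w. v \<in> S \<Longrightarrow> \<not> om v w \<Longrightarrow> w \<noteq> 0 \<Longrightarrow> w \<noteq> v \<Longrightarrow> w \<in> S \<longleftrightarrow> v + w \<notin> S"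
  shows "(\<exists>q. quad q \<and> (\<forall>f\<in>H. \<forall>x. q (f x) = q x)) \<or> (\<exists>z. z \<noteq> 0 \<and> (\<forall>f\<in>H. f z = z))"
proof -
  define q where "q x \<longleftrightarrow> x \<in> S" for x
  have inv': "q (f x) = q x" if "f \<in> H" for f x
    using inv[OF that, of x] inv[OF H_ginv[OF that], of "f x"] Isom_inv_f[OF H_Isom[OF that]] by (auto simp: q_def)
  have "q (x + y) \<longleftrightarrow> q x \<noteq> q y" if xy: "\<not> om x y" for x y
  proof (cases "x = 0 \<or> y = 0 \<or> x = y")
    case False
    have 1: "x + y \<noteq> 0" "x + y \<noteq> x" "x + y \<noteq> y" using False by (auto simp: add_eq_0_iff_eq)
    show ?thesis
      using plane[of x y] plane[of y x] plane[of "x + y" x] 1 False xy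
      by (auto simp: q_def om_sym ac_simps)
  qed (use S0 in \<open>auto simp: q_def\<close>)
  then have "quad q \<or> (\<forall>x y. q (x + y) \<longleftrightarrow> q x \<noteq> q y)"
    by (rule additive_on_orthogonal_pairs)
  then show ?thesis
  proof
    assume "\<forall>x y. q (x + y) \<longleftrightarrow> q x \<noteq> q y"
    then obtain z where z: "\<And>x. q x \<longleftrightarrow> om x z" using functional_rep[of q] by blast
    have z0: "z \<noteq> 0" using z S0 by (auto simp: q_def)
    have fz: "f z = z" if f: "f \<in> H" for f
    proof (rule om_ext)
      fix x
      have "om (f z) x = om (f z) (f (ginv f x))" by (simp add: Isom_f_inv[OF H_Isom[OF f]])
      also have "\<dots> = q (ginv f x)" using z by (simp add: Isom_om[OF H_Isom[OF f]] om_sym)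
      also have "\<dots> = om z x" using inv'[OF H_ginv[OF f]] z by (simp add: om_sym)
      finally show "om (f z) x = om z x" .
    qed
    show ?thesis by (intro disjI2 exI[of _ z] conjI ballI z0 fz)
  next
    assume "quad q"
    then show ?thesis by (intro disjI1 exI[of _ q] conjI ballI allI inv')
  qed
qed

text \<open>If \<open>x\<close> and \<open>f x\<close> are not orthogonal, the transvection at \<open>x + f x\<close> enlarges the fixed space
  of \<open>f\<close>; otherwise a first transvection at some \<open>z + f z\<close> reduces to this case.\<close>

lemma generated_by_transvections:
  assumes all: "\<And>c. transv c \<in> H" shows "H = Isom"
proof -
  define fx where "fx f = {x. f x = x}" for f :: "'a \<Rightarrow> 'a"
  have step: "fx f \<union> {x} \<subseteq> fx (transv (x + f x) \<circ> f)"
    if f: "f \<in> Isom" "om x (f x)" for f x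
  proof -
    have "om y (f x) = om y x" if "f y = y" for y using Isom_om[OF f(1), of y x] that by simp
    then show ?thesis using f by (auto simp: fx_def transv_def om_sym ac_simps)
  qed
  have *: "f \<in> Isom \<Longrightarrow> f \<in> H" for f
  proof (induction "card (- fx f)" arbitrary: f rule: less_induct)
    case less
    note f = less.prems
    have IH: "f \<in> H" if h: "h \<in> H" "fx f \<subset> fx (h \<circ> f)" for h
    proof -
      have "card (- fx (h \<circ> f)) < card (- fx f)" using h by (intro psubset_card_mono) auto
      then have "h \<circ> f \<in> H" using less.hyps f H_Isom[OF h(1)] by simp
      then show ?thesis using H_comp_left[OF h(1)] by blast
    qed
    show ?case
    proof (cases "\<exists>x. om x (f x)")
      case True
      then obtain x where x: "om x (f x)" by blast
      then have "x \<notin> fx f" by (auto simp: fx_def)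
      then show ?thesis using IH[OF all] step[OF f x] by blast
    next
      case False
      show ?thesis
      proof (cases "\<exists>x. f x \<noteq> x")
        case True
        then obtain x where x: "f x \<noteq> x" by blast
        have pol: "om x (f z) = om z (f x)" for z
          using False Isom_add[OF f, of x z] by (metis om_add om_add_right)
        have "\<exists>z. om x (f z) \<noteq> om x z"
          using pol om_ext[of x "f x"] x by (metis om_sym)
        then obtain z where z: "om x (f z) \<noteq> om x z" by blast
        define w where "w = z + f z"
        have w: "om x w" "om (f x) w"
          using z pol[of z] Isom_om[OF f, of x z] by (auto simp: w_def om_sym)
        define k where "k = transv w \<circ> f"
        have k: "k \<in> Isom" using f by (simp add: k_def)
        have kx: "om x (k x)" using w False by (auto simp: k_def transv_def)
        have "om y (f z) = om y z" if "f y = y" for y using Isom_om[OF f, of y z] that by simp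
        then have "fx f \<subseteq> fx k" by (auto simp: fx_def k_def transv_def w_def)
        moreover have "x \<notin> fx f" using x by (simp add: fx_def)
        moreover have "(transv (x + k x) \<circ> transv w) \<circ> f = transv (x + k x) \<circ> k"
          by (simp only: k_def comp_assoc)
        ultimately have "fx f \<subset> fx ((transv (x + k x) \<circ> transv w) \<circ> f)"
          using step[OF k kx] by auto
        then show ?thesis using IH H_comp all by blast
      next
        case False
        then have "f = id" by auto
        then show ?thesis using H_id by simp
      qed
    qed
  qed
  then show ?thesis using H_sub_Isom by blast
qed

context
  assumes types: "\<And>v. v \<noteq> 0 \<Longrightarrow> isF v \<or> isN v \<or> isM v \<or> isR v"
    and noR: "\<And>v. v \<noteq> 0 \<Longrightarrow> \<not> isR v"
begin

text \<open>H contains enough of the radical to carry one transvection at a vector not orthogonal to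
  v to a whole class of such transvections, the classes being told apart by the value of the form at
  \<open>y\<close>. Once both classes are covered, \<open>transv_closed\<close> reaches the vectors
  orthogonal to v.\<close>

lemma F_transvections:
  assumes v: "v \<noteq> 0" and F: "isF v"
  shows "transv c \<in> H"
proof -
  obtain y where y: "\<not> om v y" "\<And>w. \<not> om v w \<Longrightarrow> unip v w False \<in> H \<longleftrightarrow> \<not> om w y"
    using F by (auto simp: isF_def)
  have Tv: "transv v \<in> H" using F by (simp add: isF_def)
  have shift: "transv (a + w) \<in> H" if a: "om a v" "transv a \<in> H" and w: "\<not> om v w" "\<not> om w y" for a w
  proof -
    have s: "unip v w False \<in> H" using y w by blast
    have 1: "transv (unip v w False a) \<in> H" using transv_image_iff[OF s] a by simp
    have 2: "transv (transv v (unip v w False a)) \<in> H" using transv_image_iff[OF Tv] 1 by simp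
    show ?thesis using 1 2 a w by (cases "om a w") (auto simp: unip_def transv_def om_sym ac_simps)
  qed
  have all: "transv c \<in> H" if out: "\<And>a. om a v \<Longrightarrow> transv a \<in> H" for c
  proof (cases "c = 0 \<or> c = v")
    case False
    then obtain a where a: "om a v" "om a c" using ex_om_values2[of v c True True] v by auto
    show ?thesis
    proof (cases "om c v")
      case False
      then show ?thesis using transv_closed[of a "a + c"] a out by simp
    qed (use out in blast)
  qed (use Tv H_id unip_zero[of 0] in \<open>auto simp: unip_self(2) transv_def[abs_def] id_def\<close>)
  show ?thesis
  proof (cases "\<exists>a. om a v \<and> transv a \<in> H")
    case True
    then obtain a where a: "om a v" "transv a \<in> H" by blast
    show ?thesis
    proof (cases "y = 0 \<or> y = v")
      case True
      have "transv z \<in> H" if "om z v" for z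
        using shift[OF a, of "a + z"] that a True by (auto simp: om_sym)
      then show ?thesis using all by blast
    next
      case False
      \<comment> \<open>Adding v to \<open>y\<close> does not change its values on vectors
        orthogonal to v, and normalizes the class of \<open>a\<close> to the value
        \<open>False\<close>.\<close>
      define y0 where "y0 = (if om a y then y + v else y)"
      have y0: "\<not> om a y0" "\<not> om v y0" "y0 \<noteq> 0" "y0 \<noteq> v"
        and wy: "\<And>w. \<not> om v w \<Longrightarrow> om w y0 = om w y"
        using y a False by (auto simp: y0_def add_eq_0_iff_eq om_sym)
      have C: "transv z \<in> H" if "transv b \<in> H" "om b v" "om z v" "om z y0 = om b y0" for b z
        using shift[of b "b + z"] that wy[of "b + z"] by (auto simp: om_sym)
      obtain w where w: "\<not> om w v" "om w y0" using ex_om_values2[of v y0 False True] v y0 by auto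
      have s: "unip v w False \<notin> H" using y(2)[of w] wy[of w] w by (auto simp: om_sym)
      \<comment> \<open>This transvection leads out of the class of \<open>a\<close>: combined with
        a suitable \<open>c\<close> of that class it gives \<open>c + w1\<close> in the other
        class.\<close>
      have "transv w \<in> H \<or> transv (v + w) \<in> H"
      proof (rule ccontr)
        assume n: "\<not> ?thesis"
        have "w \<noteq> 0" using w by auto
        then have "isM w" using types noR n by (auto simp: isF_def isN_def)
        then have "unip w v True \<in> H" using s w unip_swap[of w v] by (auto simp: isM_def om_sym)
        then show False using unip_True_transv_iff[of w v] w n Tv by (auto simp: ac_simps)
      qed
      then obtain w1 where w1: "transv w1 \<in> H" "\<not> om w1 v" "om w1 y0"
        using w y0 by (auto intro: that[of w] that[of "v + w"])
      have "\<exists>c. om c v = True \<and> om c y0 = False \<and> om c w1 = True"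
        using v y0 w1 by (intro ex_om_values3) (auto simp: om_sym)
      then obtain c where c: "om c v" "\<not> om c y0" "om c w1" by auto
      have Tc: "transv c \<in> H" using C[OF a(2,1) c(1)] c y0 by simp
      have "transv (c + w1) \<in> H" using transv_closed[OF Tc w1(1) c(3)] .
      then have "transv z \<in> H" if "om z v" for z
        using C[of "c + w1" z] C[OF a(2,1) that] that c w1 y0 by auto
      then show ?thesis using all by blast
    qed
  next
    case False
    then have out: "\<And>a. om a v \<Longrightarrow> transv a \<notin> H" by blast
    obtain a where a: "om a v" using ex_om[OF v] by blast
    have a0: "a \<noteq> 0" using a by auto
    \<comment> \<open>To refute this case, the radical at \<open>a\<close> is used to move
      \<open>v\<close>: with w1, w2 orthogonal to v and a but not to each other, v goes to v + w2
      and then to v + w2 + w1 + a, which is not orthogonal to v.\<close>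
    have "isM a" using types[OF a0] noR[OF a0] out[OF a] by (auto simp: isF_def isN_def)
    then have M: "\<And>w. \<not> om a w \<Longrightarrow> unip a w False \<in> H \<or> unip a w True \<in> H" by (simp add: isM_def)
    have 4: "card {0, v, a, v + a} \<le> 4" using card_length[of "[0, v, a, v + a]"] by simp
    obtain e where e: "\<not> om e v" "\<not> om e a" "e \<noteq> 0"
      using ex_perp[OF subsp_plane[of v a], of 0] 4 by (auto simp: perp_def)
    obtain f where f: "\<not> om f v" "\<not> om f a" "\<not> om f e" "f \<noteq> 0" "f \<noteq> e"
      using ex_perp[OF subsp_extend[OF subsp_plane[of v a], of e], of e] 4
        card_extend[of "{0, v, a, v + a}" e] by (auto simp: perp_def)
    have "\<exists>w1. w1 \<noteq> 0 \<and> \<not> om w1 v \<and> \<not> om w1 a \<and> unip a w1 False \<in> H"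
    proof (cases "unip a e False \<in> H \<or> unip a f False \<in> H")
      case False
      then have "unip a (e + f) False \<in> H"
        using M[of e] M[of f] unip_comp_mem[of a e f True True] e f by (auto simp: om_sym)
      then show ?thesis using e f by (intro exI[of _ "e + f"]) (auto simp: add_eq_0_iff_eq)
    qed (use e f in auto)
    then obtain w1 where w1: "w1 \<noteq> 0" "\<not> om w1 v" "\<not> om w1 a" "unip a w1 False \<in> H" by blast
    have "\<exists>z. om z v = False \<and> om z a = False \<and> om z w1 = True"
      using v a a0 w1 by (intro ex_om_values3) (auto simp: om_sym)
    then obtain z where z: "\<not> om z v" "\<not> om z a" "om z w1" by auto
    define w2 where "w2 = (if unip a z False \<in> H then z else w1 + z)"
    have w2: "\<not> om w2 v" "\<not> om w2 a" "om w2 w1"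
      using z w1 by (auto simp: w2_def)
    have w2H: "unip a w2 False \<in> H"
    proof (cases "unip a z False \<in> H")
      case False
      have o: "\<not> om a w1" "\<not> om a z" "om w1 z" using z w1 by (auto simp: om_sym)
      show ?thesis using unip_comp_mem[OF o(1,2) w1(4), of True] False M[OF o(2)] o(3) by (simp add: w2_def)
    qed (simp add: w2_def)
    have im1: "unip a w1 False v = v + w1" and im2: "unip a w2 False v = v + w2"
      using a w1 w2 by (auto simp: unip_def om_sym)
    have "transv (v + w2) \<in> H" using transv_image_iff[OF w2H, of v] Tv im2 by simp
    moreover have "unip a w1 False (unip a w1 False (v + w2)) = v + w2"
      using w1 by (intro unip_inv) (auto simp: om_sym)
    ultimately have "transv (unip a w1 False (v + w2)) \<in> H"
      using transv_image_iff[OF w1(4)] by metis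
    moreover have "om (unip a w1 False (v + w2)) v"
    proof -
      have "om (unip a w1 False (v + w2)) v = om (unip a w1 False (unip a w1 False (v + w2))) (unip a w1 False v)"
        using Isom_om[OF H_Isom[OF w1(4)]] by simp
      then show ?thesis
        using \<open>unip a w1 False (unip a w1 False (v + w2)) = v + w2\<close> im1 w1 w2 by (simp add: om_sym)
    qed
    ultimately show ?thesis using out by blast
  qed
qed

end
end

section \<open>Counting cosets\<close>

lemma card_le_image_times:
  assumes "finite A" "\<And>b. b \<in> A \<Longrightarrow> card {a \<in> A. f a = f b} \<le> k"
  shows "card A \<le> card (f ` A) * k"
proof -
  have "card A = (\<Sum>c\<in>f ` A. card {a \<in> A. f a = c})"
    using sum.image_gen[OF assms(1), of "\<lambda>_. 1::nat" f] by simp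
  also have "\<dots> \<le> (\<Sum>c\<in>f ` A. k)"
    by (rule sum_mono) (use assms(2) in auto)
  finally show ?thesis by simp
qed

lemma card_mult_disjoint_le:
  assumes "finite \<Omega>" "finite I" "\<And>i. i \<in> I \<Longrightarrow> A i \<subseteq> \<Omega>" "\<And>i. i \<in> I \<Longrightarrow> m \<le> card (A i) * k"
    and "\<And>i j. i \<in> I \<Longrightarrow> j \<in> I \<Longrightarrow> i \<noteq> j \<Longrightarrow> A i \<inter> A j = {}"
  shows "card I * m \<le> card \<Omega> * (k::nat)"
proof -
  have "card I * m = (\<Sum>i\<in>I. m)" by simp
  also have "\<dots> \<le> (\<Sum>i\<in>I. card (A i) * k)" by (rule sum_mono) (rule assms(4))
  also have "\<dots> = (\<Sum>i\<in>I. card (A i)) * k" by (simp add: sum_distrib_right)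
  also have "(\<Sum>i\<in>I. card (A i)) = card (\<Union>i\<in>I. A i)"
    by (subst card_UN_disjoint) (use assms in \<open>auto intro: finite_subset\<close>)
  also have "\<dots> \<le> card \<Omega>" by (rule card_mono) (use assms in auto)
  finally show ?thesis by simp
qed

section \<open>Translates of a subspace under the stabilizer of a vector\<close>

context symplectic_F2
begin

definition stab :: "'a \<Rightarrow> ('a \<Rightarrow> 'a) set" where
  "stab v = {f \<in> Isom. f v = v}"

text \<open>Preimages instead of images, because the cosets to be counted are the right cosets H f:
  for \<open>X\<close> invariant under the stabilizer of v in H, and f fixing v, the preimage of
  \<open>X\<close> under f depends only on H f.\<close>

definition translates :: "'a \<Rightarrow> 'a set \<Rightarrow> 'a set set" where
  "translates v X = (\<lambda>f. f -` X) ` stab v"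

lemma card_perp1: "v \<noteq> 0 \<Longrightarrow> card (perp {0, v}) * 2 = 4 ^ g"
  using card_perp[OF subsp_pair[of v]] by simp

lemma mem_perp1: "x \<in> perp {0, v} \<longleftrightarrow> \<not> om x v"
  by (auto simp: perp_def)

lemma stabD: "f \<in> stab v \<Longrightarrow> f \<in> Isom" "f \<in> stab v \<Longrightarrow> f v = v"
  by (auto simp: stab_def)

lemma stab_om: "f \<in> stab v \<Longrightarrow> om (f x) v = om x v" "f \<in> stab v \<Longrightarrow> om v (f x) = om v x"
  by (metis stabD Isom_om)+

lemma stab_comp: "f \<in> stab v \<Longrightarrow> h \<in> stab v \<Longrightarrow> f \<circ> h \<in> stab v"
  by (auto simp: stab_def)

lemma transv_stab: "\<not> om v c \<Longrightarrow> transv c \<in> stab v"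
  by (simp add: stab_def transv_def)

lemma unip_stab: "\<not> om v w \<Longrightarrow> unip v w e \<in> stab v"
  by (simp add: stab_def unip_def)

lemma self_translate: "X \<in> translates v X"
  unfolding translates_def by (rule image_eqI[of _ _ id]) (auto simp: stab_def)

lemma translate_subsp:
  assumes X: "subsp X" "v \<in> X" "X \<subseteq> perp {0, v}" and X': "X' \<in> translates v X"
  shows "subsp X'" "v \<in> X'" "X' \<subseteq> perp {0, v}" "card X' = card X"
proof -
  obtain f where f: "f \<in> stab v" "X' = f -` X" using X' by (auto simp: translates_def)
  note Isom = stabD(1)[OF f(1)]
  show "subsp X'" using X(1) by (auto simp: f(2) subsp_def Isom_zero[OF Isom] Isom_add[OF Isom])
  show "v \<in> X'" using X(2) stabD(2)[OF f(1)] by (simp add: f(2))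
  show "X' \<subseteq> perp {0, v}"
    using X(3) stab_om[OF f(1)] by (auto simp: f(2) mem_perp1 subset_iff)
  show "card X' = card X"
    unfolding f(2) using Isom_bij[OF Isom] by (intro card_vimage_inj) (auto simp: bij_def)
qed

text \<open>If p and p' are not orthogonal, the transvection at p + p' exchanges them; in general
  two such steps through a common \<open>z\<close> suffice. The case v = 0 is included: it gives
  transitivity of the whole group on nonzero vectors, as \<open>idx_fix_vector\<close>
  requires.\<close>

lemma stab_transitive:
  assumes p: "\<not> om p v" "p \<noteq> 0" "p \<noteq> v" and p': "\<not> om p' v" "p' \<noteq> 0" "p' \<noteq> v"
  shows "\<exists>f\<in>stab v. f p = p'"
proof -
  have 1: "\<exists>f\<in>stab v. f p = p'" if "\<not> om p v" "\<not> om p' v" "om p p'" for p p'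
    using that by (intro bexI[of _ "transv (p + p')"] transv_stab) (auto simp: transv_def om_sym)
  obtain z where z: "\<not> om z v" "om z p" "om z p'"
  proof (cases "p' = p \<or> p' = v + p \<or> v = 0")
    case True
    then show ?thesis
    proof (cases "v = 0")
      case True
      then show ?thesis using ex_om_value[of p True] ex_om_values2[of p p' True True] that p p' by (cases "p = p'") auto
    next
      case False
      then show ?thesis using ex_om_values2[of v p False True] that p True by auto
    qed
  next
    case False
    then show ?thesis using ex_om_values3[of v p p' False True True] that p p' by auto
  qed
  obtain f where f: "f \<in> stab v" "f p = z" using 1[of p z] z p by (auto simp: om_sym)
  obtain h where h: "h \<in> stab v" "h z = p'" using 1[of z p'] z p' by auto
  show ?thesis using stab_comp[OF h(1) f(1)] f h by (intro bexI[of _ "h \<circ> f"]) auto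
qed

lemma card_translates_through:
  assumes f: "f \<in> stab v"
  shows "card {X' \<in> translates v X. f p \<in> X'} \<le> card {X' \<in> translates v X. p \<in> X'}"
proof (rule card_inj_on_le[of "\<lambda>X'. f -` X'"])
  have "surj f" using Isom_bij[OF stabD(1)[OF f]] by (simp add: bij_def)
  then show "inj_on ((-`) f) {X' \<in> translates v X. f p \<in> X'}"
    by (intro inj_onI) (metis surj_image_vimage_eq)
  show "(-`) f ` {X' \<in> translates v X. f p \<in> X'} \<subseteq> {X' \<in> translates v X. p \<in> X'}"
    by (auto simp: translates_def vimage_comp intro!: stab_comp f imageI)
qed simp

text \<open>Double count of incidences between translates and the 2 * 4^(g-1) - 2 points orthogonal
  to v other than 0 and v. By transitivity each point lies on at least \<open>l\<close>
  translates.\<close>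

lemma card_translates_ge:
  assumes v: "v \<noteq> 0" and X: "subsp X" "v \<in> X" "X \<subseteq> perp {0, v}"
    and p: "\<not> om p v" "p \<noteq> 0" "p \<noteq> v" "l \<le> card {X' \<in> translates v X. p \<in> X'}"
  shows "card (translates v X) * (card X - 2) \<ge> (2 * 4 ^ (g - 1) - 2) * l"
proof -
  define Q where "Q = perp {0, v} - {0, v}"
  have "card (perp {0, v}) * 2 = 4 * 4 ^ (g - 1)"
    using card_perp1[OF v] g_ge_3 by (simp flip: power_Suc)
  then have cQ: "card Q = 2 * 4 ^ (g - 1) - 2"
    using v unfolding Q_def by (subst card_Diff_subset) (auto simp: mem_perp1)
  have "card Q * l = (\<Sum>q\<in>Q. l)" by simp
  also have "\<dots> \<le> (\<Sum>q\<in>Q. card {X' \<in> translates v X. q \<in> X'})"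
  proof (rule sum_mono)
    fix q assume "q \<in> Q"
    then obtain f where "f \<in> stab v" "f q = p"
      using stab_transitive[of q v p] p by (auto simp: Q_def mem_perp1)
    then show "l \<le> card {X' \<in> translates v X. q \<in> X'}"
      using card_translates_through[of f v X q] p(4) by simp
  qed
  also have "\<dots> = (\<Sum>q\<in>Q. \<Sum>X'\<in>translates v X. if q \<in> X' then 1 else 0)"
    by (simp add: sum.If_cases Collect_conj_eq)
  also have "\<dots> = (\<Sum>X'\<in>translates v X. \<Sum>q\<in>Q. if q \<in> X' then 1 else 0)"
    by (rule sum.swap)
  also have "\<dots> = (\<Sum>X'\<in>translates v X. card X - 2)"
  proof (rule sum.cong[OF refl])
    fix X' assume "X' \<in> translates v X"
    note X' = translate_subsp[OF X this]
    have "Q \<inter> X' = X' - {0, v}" using X' by (auto simp: Q_def)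
    then show "(\<Sum>q\<in>Q. if q \<in> X' then 1 else 0) = card X - 2"
      using X' v subsp_zero_mem[OF X'(1)] by (simp add: sum.If_cases card_Diff_subset)
  qed
  finally show ?thesis by (simp add: cQ)
qed

lemma half_subset:
  assumes "subsp Y" "R \<subseteq> {d \<in> Y. \<not> om d c}" "z \<in> Y" "om z c"
  shows "2 * card R \<le> card Y"
proof -
  have R: "\<And>d. d \<in> R \<Longrightarrow> d \<in> Y \<and> \<not> om d c" using assms(2) by blast
  have "R \<inter> (+) z ` R = {}" by (auto dest!: R simp: assms(4))
  then have "card R + card ((+) z ` R) = card (R \<union> (+) z ` R)"
    by (subst card_Un_disjoint) auto
  also have "\<dots> \<le> card Y"
    using assms(1,3) R by (intro card_mono) (auto intro: subspD)
  also have "card ((+) z ` R) = card R" by (rule card_image) (auto simp: inj_on_def)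
  finally show ?thesis by simp
qed

text \<open>Compare the two conditions at points of \<open>Y\<close>, and then at z + c, where z in
  \<open>Y\<close> is not orthogonal to c.\<close>

lemma transv_vimage_eqD:
  assumes Y: "subsp Y" and c: "c \<notin> Y" "c \<notin> perp Y" and c': "c' \<notin> Y" and eq: "transv c -` Y = transv c' -` Y"
  shows "c + c' \<in> Y \<and> c + c' \<in> perp Y \<and> \<not> om (c + c') c"
proof -
  obtain z where z: "z \<in> Y" "om z c" using c by (auto simp: perp_def om_sym)
  have iff: "x + a \<in> Y \<longleftrightarrow> a \<in> Y" if "x \<in> Y" for x a using subsp_add_iff[OF Y that] .
  have mem: "transv c x \<in> Y \<longleftrightarrow> transv c' x \<in> Y" for x using eq by auto
  have same: "om x c = om x c'" if "x \<in> Y" for x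
    using mem[of x] iff[OF that] that c(1) c' by (auto simp: transv_def split: if_splits)
  have zc: "om (z + c) c'" "z + (c + c') \<in> Y"
    using mem[of "z + c"] z c iff[OF z(1)] by (auto simp: transv_def ac_simps split: if_splits)
  have "c + c' \<in> Y" using zc(2) iff[OF z(1)] by blast
  moreover have "c + c' \<in> perp Y" using same by (auto simp: perp_def om_sym)
  moreover have "\<not> om (c + c') c" using zc(1) same[OF z(1)] z by (auto simp: om_sym)
  ultimately show ?thesis by blast
qed

text \<open>Transvections at vectors of \<open>E\<close> fix v and p, and those at vectors outside
  \<open>Y\<close> and \<open>perp Y\<close> move \<open>Y\<close>. Two of them give the same
  translate only if their centers differ by a vector of a proper subspace of \<open>Y\<close>, so
  the fibres have at most half the size of \<open>Y\<close>. The translate \<open>Y\<close> itself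
  adds one.\<close>

lemma many_translates_through_point:
  assumes v: "v \<noteq> 0" and Y: "subsp Y" "v \<in> Y" "Y \<subseteq> perp {0, v}" and card8: "8 \<le> card Y"
  shows "\<exists>p. \<not> om p v \<and> p \<noteq> 0 \<and> p \<noteq> v \<and>
    2 * 4 ^ (g - 1) + 4 \<le> card {X' \<in> translates v Y. p \<in> X'} * card Y + 2 * card (perp Y)"
proof -
  define Z where "Z = perp Y"
  have "\<not> Y \<subseteq> {0, v}" using card8 card_mono[of "{0, v}" Y] v by auto
  \<comment> \<open>Taking p outside \<open>perp Y\<close> where possible ensures that only half of
    \<open>Y\<close> lies in \<open>E\<close>.\<close>
  then obtain p where p: "p \<in> Y" "p \<noteq> 0" "p \<noteq> v" "Y \<subseteq> Z \<or> p \<notin> Z"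
  proof (cases "Y \<subseteq> Z")
    case False
    then obtain p where "p \<in> Y" "p \<notin> Z" by blast
    moreover have "0 \<in> Z" "v \<in> Z"
      using subsp_zero_mem[OF subsp_perp[of Y]] Y by (auto simp: Z_def perp_def om_sym subset_iff)
    ultimately show thesis using that by metis
  qed (use \<open>\<not> Y \<subseteq> {0, v}\<close> that in blast)
  have pv: "\<not> om p v" using p Y by (auto simp: mem_perp1 subset_iff)
  define E where "E = perp {0, v, p, v + p}"
  have E: "x \<in> E \<longleftrightarrow> \<not> om x v \<and> \<not> om x p" for x by (auto simp: E_def perp_def)
  have "card {0, v, p, v + p} = 4" using v p by (auto simp: add_eq_0_iff_eq)
  then have cE: "card E = 4 ^ (g - 1)"
    using card_perp[OF subsp_plane[of v p]] g_ge_3 power_Suc[of "4::nat" "g - 1"] by (simp add: E_def)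
  have ZE: "Z \<subseteq> E" using p Y by (auto simp: Z_def E perp_def)
  define Eo where "Eo = E - (Y \<union> Z)"
  have "card E + 2 \<le> card Eo + card Z + card Y div 2"
  proof (cases "Y \<subseteq> Z")
    case True
    then have "Eo = E - Z" by (auto simp: Eo_def)
    then have "card Eo = card E - card Z" using ZE by (simp add: card_Diff_subset)
    moreover have "card Z \<le> card E" using ZE by (simp add: card_mono)
    ultimately show ?thesis using card8 by simp
  next
    case False
    then obtain z where z: "z \<in> Y" "om z p" using p by (auto simp: Z_def perp_def om_sym)
    define Y1 where "Y1 = {y \<in> Y. \<not> om y p}"
    have 1: "2 * card Y1 \<le> card Y" using half_subset[OF Y(1) _ z] by (simp add: Y1_def)
    have "{0, v} \<subseteq> Y1 \<inter> Z"
      using Y pv subsp_zero_mem by (auto simp: Y1_def Z_def perp_def mem_perp1 om_sym subset_iff)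
    then have 2: "2 \<le> card (Y1 \<inter> Z)" using card_mono[of "Y1 \<inter> Z" "{0, v}"] v by simp
    have "E \<subseteq> Eo \<union> (Y1 \<union> Z)" by (auto simp: Eo_def Y1_def E)
    then have "card E \<le> card (Eo \<union> (Y1 \<union> Z))" by (simp add: card_mono)
    also have "\<dots> \<le> card Eo + card (Y1 \<union> Z)" by (rule card_Un_le)
    finally show ?thesis using card_Un_Int[of Y1 Z] 1 2 by simp
  qed
  moreover define N where "N = card ((\<lambda>c. transv c -` Y) ` Eo)"
  have "card Eo \<le> N * (card Y div 2)"
    unfolding N_def
  proof (rule card_le_image_times)
    fix c assume c: "c \<in> Eo"
    then have c1: "c \<notin> Y" "c \<notin> perp Y" by (auto simp: Eo_def Z_def)
    obtain z where z: "z \<in> Y" "om z c" using c1 by (auto simp: perp_def om_sym)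
    have "{a \<in> Eo. transv a -` Y = transv c -` Y} \<subseteq> (+) c ` {d \<in> Y. \<not> om d c}"
    proof
      fix a assume a: "a \<in> {a \<in> Eo. transv a -` Y = transv c -` Y}"
      then have "c + a \<in> Y \<and> c + a \<in> perp Y \<and> \<not> om (c + a) c"
        by (intro transv_vimage_eqD[OF Y(1) c1]) (auto simp: Eo_def)
      then show "a \<in> (+) c ` {d \<in> Y. \<not> om d c}" by (intro image_eqI[of _ _ "c + a"]) auto
    qed
    then have "card {a \<in> Eo. transv a -` Y = transv c -` Y} \<le> card ((+) c ` {d \<in> Y. \<not> om d c})"
      by (simp add: card_mono)
    also have "\<dots> \<le> card {d \<in> Y. \<not> om d c}" by (simp add: card_image_le)
    also have "\<dots> \<le> card Y div 2" using half_subset[OF Y(1) _ z, of "{d \<in> Y. \<not> om d c}"] by simp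
    finally show "card {a \<in> Eo. transv a -` Y = transv c -` Y} \<le> card Y div 2" .
  qed simp
  moreover have "N * (card Y div 2) * 2 \<le> N * card Y"
    using mult_le_mono2[of "card Y div 2 * 2" "card Y" N] by (simp add: mult.assoc)
  moreover have "N + 1 \<le> card {X' \<in> translates v Y. p \<in> X'}"
  proof -
    have "Y \<notin> (\<lambda>c. transv c -` Y) ` Eo"
    proof
      assume "Y \<in> (\<lambda>c. transv c -` Y) ` Eo"
      then obtain c where c: "c \<in> Eo" "Y = transv c -` Y" by blast
      then obtain z where z: "z \<in> Y" "om z c" by (auto simp: Eo_def Z_def perp_def om_sym)
      have "transv c z \<in> Y" using z c by blast
      then show False using z c subsp_add_iff[OF Y(1) z(1), of c] by (auto simp: transv_def Eo_def)
    qed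
    then have "N + 1 = card (insert Y ((\<lambda>c. transv c -` Y) ` Eo))" by (simp add: N_def)
    also have "\<dots> \<le> card {X' \<in> translates v Y. p \<in> X'}"
    proof (rule card_mono)
      show "insert Y ((\<lambda>c. transv c -` Y) ` Eo) \<subseteq> {X' \<in> translates v Y. p \<in> X'}"
        using self_translate p by (auto simp: translates_def Eo_def E transv_def om_sym intro!: imageI transv_stab)
    qed simp
    finally show ?thesis .
  qed
  then have "(N + 1) * card Y \<le> card {X' \<in> translates v Y. p \<in> X'} * card Y" by (rule mult_le_mono1)
  moreover have "2 * (card Y div 2) \<le> card Y" by simp
  ultimately have "2 * card E + 4 \<le> card {X' \<in> translates v Y. p \<in> X'} * card Y + 2 * card Z"
    unfolding add_mult_distrib mult_1 by linarith
  then show ?thesis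
    using pv p cE by (intro exI[of _ p]) (simp add: Z_def)
qed

lemma perp_vimage:
  assumes f: "f \<in> Isom" shows "perp (f -` X) = f -` perp X"
proof -
  have 1: "om (f x) z = om x (ginv f z)" for x z
    using Isom_om[OF f, of x "ginv f z"] Isom_f_inv[OF f] by simp
  have 2: "om x y = om (f x) (f y)" for x y using Isom_om[OF f] by simp
  show ?thesis
  proof (intro Set.set_eqI iffI)
    fix x assume x: "x \<in> perp (f -` X)"
    have "\<not> om (f x) z" if "z \<in> X" for z
      using x that unfolding 1 by (simp add: perp_def Isom_f_inv[OF f])
    then show "x \<in> f -` perp X" by (simp add: perp_def)
  next
    fix x assume x: "x \<in> f -` perp X"
    then show "x \<in> perp (f -` X)" unfolding perp_def by (simp add: 2[of x])
  qed
qed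

lemma card_translates_perp: "card (translates v (perp X)) \<le> card (translates v X)"
proof -
  have "translates v (perp X) \<subseteq> perp ` translates v X"
    unfolding translates_def image_image
    by (intro image_subsetI image_eqI[of _ "\<lambda>f. perp (f -` X)"]) (auto simp: perp_vimage stabD)
  then show ?thesis by (meson card_image_le card_mono finite le_trans)
qed

text \<open>The lower bounds are 2 (4^g - 4) and 4^g - 4, the thresholds against which
  \<open>point_types\<close> plays the index. Since \<open>perp K\<close> has no more translates
  than \<open>K\<close>, incidences can be counted for either subspace; in the first bound the
  smaller one is used.\<close>

lemma card_translates_times_perp:
  assumes v: "v \<noteq> 0" and K: "subsp K" "v \<in> K" "K \<subseteq> perp {0, v}" "K \<noteq> {0, v}"
  shows "8 \<le> card (perp K) \<Longrightarrow> 8 * 4 ^ (g - 1) - 8 \<le> card (translates v K) * card (perp K)"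
    and "card (perp K) = 4 \<Longrightarrow> 4 * 4 ^ (g - 1) - 4 \<le> card (translates v K) * card (perp K)"
proof -
  define x where "x = (4::nat) ^ (g - 1)"
  have x: "4 * x = 4 ^ g" using g_ge_3 by (simp add: x_def flip: power_Suc)
  have x16: "16 \<le> x" using g_ge_3 power_increasing[of 2 "g - 1" "4::nat"] by (simp add: x_def)
  define Y where "Y = perp K"
  have Y: "subsp Y" "v \<in> Y" "Y \<subseteq> perp {0, v}"
    using K subsp_perp by (auto simp: Y_def perp_def subset_iff om_sym)
  have KY: "card K * card Y = 4 * x" using card_perp[OF K(1)] x by (simp add: Y_def)
  have through: "1 \<le> card {X' \<in> translates v X. p \<in> X'}" if "p \<in> X" for X p
    using self_translate[of X v] that by (simp add: Suc_le_eq card_gt_0_iff) blast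
  have le: "card (translates v Y) \<le> card (translates v K)"
    unfolding Y_def by (rule card_translates_perp)
  {
    assume 4: "card (perp K) = 4"
    then have "\<not> Y \<subseteq> {0, v}" using card_mono[of "{0, v}" Y] v by (auto simp: Y_def)
    then obtain p where p: "p \<in> Y" "p \<noteq> 0" "p \<noteq> v" by blast
    then have "\<not> om p v" using Y by (auto simp: mem_perp1 subset_iff)
    then have "(2 * x - 2) * 1 \<le> card (translates v Y) * (card Y - 2)"
      unfolding x_def using card_translates_ge[OF v Y, of p 1] through p by blast
    then show "4 * 4 ^ (g - 1) - 4 \<le> card (translates v K) * card (perp K)"
      using 4 le by (simp add: Y_def x_def)
  }
  assume 8: "8 \<le> card (perp K)"
  obtain k where k: "card Y = 2 ^ k" "k \<le> 2 * g" using card_subsp_power[OF Y(1)] by blast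
  obtain j where j: "card K = 2 ^ j" "j \<le> 2 * g" using card_subsp_power[OF K(1)] by blast
  have "(2::nat) ^ (j + k) = 2 ^ (2 * g)" using KY x j k by (simp add: power_add power_mult)
  then have jk: "j + k = 2 * g" by (simp only: power_inject_exp)
  show "8 * 4 ^ (g - 1) - 8 \<le> card (translates v K) * card (perp K)"
  proof (cases "k \<le> g")
    \<comment> \<open>Here |K| <= 2^(g-1), so |K|^2 <= x and |Y| = 4x / |K| >= 4 |K|. One translate
      of \<open>K\<close> through each point is then enough.\<close>
    case False
    define m where "m = card K"
    have "{0, v} \<subseteq> K" using K subsp_zero_mem by blast
    then have "{0, v} \<subset> K" using K by blast
    then have "card {0, v} < m" unfolding m_def by (intro psubset_card_mono) auto
    then have m: "2 < m" using v by simp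
    obtain p where p: "p \<in> K" "p \<noteq> 0" "p \<noteq> v" using \<open>{0, v} \<subset> K\<close> by blast
    then have "\<not> om p v" using K by (auto simp: mem_perp1 subset_iff)
    then have 1: "(2 * x - 2) * 1 \<le> card (translates v K) * (m - 2)"
      unfolding x_def m_def using card_translates_ge[OF v K(1-3), of p 1] through p by blast
    have "2 * j \<le> 2 * (g - 1)" using False jk by simp
    then have "(2::nat) ^ (2 * j) \<le> 2 ^ (2 * (g - 1))" by (intro power_increasing) auto
    then have "m * m \<le> x" by (simp add: m_def j x_def power_mult power2_eq_square[symmetric] power_mult[symmetric] mult.commute[of j])
    then have "m * (4 * (m - 2)) \<le> m * card Y"
      using KY m by (simp add: m_def diff_mult_distrib2 algebra_simps)
    then have 2: "4 * (m - 2) \<le> card Y" using m by simp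
    have "(8 * x - 8) * (m - 2) = (2 * x - 2) * (4 * (m - 2))" by (simp add: diff_mult_distrib)
    also have "\<dots> \<le> (card (translates v K) * (m - 2)) * card Y"
      using mult_le_mono[OF 1 2] by simp
    finally have "(8 * x - 8) * (m - 2) \<le> (card (translates v K) * card Y) * (m - 2)"
      by (simp add: ac_simps)
    then show ?thesis using m by (simp add: x_def Y_def)
  next
    case True
    obtain p where p: "\<not> om p v" "p \<noteq> 0" "p \<noteq> v"
      "2 * x + 4 \<le> card {X' \<in> translates v Y. p \<in> X'} * card Y + 2 * card K"
      using many_translates_through_point[OF v Y] 8 perp_perp[OF K(1)] by (auto simp: Y_def x_def)
    define n where "n = card {X' \<in> translates v Y. p \<in> X'}"
    have n: "2 * x + 4 \<le> n * card Y + 2 * card K" using p by (simp add: n_def)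
    have "(2 * x - 2) * n \<le> card (translates v Y) * (card Y - 2)"
      unfolding x_def by (rule card_translates_ge[OF v Y p(1-3)]) (simp add: n_def)
    also have "\<dots> \<le> card (translates v K) * (card Y - 2)" using le by (rule mult_le_mono1)
    finally have *: "(2 * x - 2) * n \<le> card (translates v K) * (card Y - 2)" .
    have "3 \<le> k"
    proof (rule ccontr)
      assume "\<not> 3 \<le> k"
      then have "(2::nat) ^ k \<le> 2 ^ 2" by (intro power_increasing) auto
      then show False using 8 k by (simp add: Y_def)
    qed
    show ?thesis
    proof (cases "k = 3")
      case True
      then have "card Y = 8" using k by simp
      then have s6: "card Y - 2 = 6" by simp
      have "8 * card K = 4 * x" using KY \<open>card Y = 8\<close> by simp
      \<comment> \<open>The tight case: 8n >= x + 4, and n = 3 against |Y| - 2 = 6 gives exactly the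
        bound. For g = 3, where x = 16, the summand 4 rules out n = 2.\<close>
      then have "3 \<le> n" using n x16 \<open>card Y = 8\<close> by simp
      then have "(2 * x - 2) * 3 \<le> (2 * x - 2) * n" by (rule mult_le_mono2)
      then have "(2 * x - 2) * 3 \<le> card (translates v K) * 6"
        using le_trans[OF _ *] \<open>card Y = 8\<close> s6 by metis
      then have "8 * x - 8 \<le> card (translates v K) * card Y"
        using \<open>card Y = 8\<close> by simp
      then show ?thesis by (simp only: Y_def x_def)
    next
      case False
      then have k4: "4 \<le> k" using \<open>3 \<le> k\<close> by simp
      then have "16 * card K \<le> card Y * card K"
        using k power_increasing[of 4 k "2::nat"] by (intro mult_le_mono1) simp
      then have "4 * card K \<le> x" using KY by (simp add: mult.commute)
      then have nY: "3 * x \<le> 2 * (n * card Y)" using n by simp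
      \<comment> \<open>Otherwise x <= 2 |Y| <= 2^(g+1), which means g <= 3, while 4 <= k <=
        g.\<close>
      have "4 \<le> n"
      proof (rule ccontr)
        assume "\<not> 4 \<le> n"
        then have "n \<le> 3" by simp
        then have "n * card Y \<le> 3 * card Y" by (rule mult_le_mono1)
        then have "x \<le> 2 * card Y" using nY by linarith
        also have "\<dots> \<le> 2 * 2 ^ g" using k True by (simp add: power_increasing)
        finally have "(2::nat) ^ (2 * (g - 1)) \<le> 2 ^ (g + 1)" by (simp add: x_def power_mult)
        then have "2 * (g - 1) \<le> g + 1" by (simp only: power_increasing_iff)
        then show False using k4 True by simp
      qed
      then have "(2 * x - 2) * 4 \<le> (2 * x - 2) * n" by (rule mult_le_mono2)
      also have "\<dots> \<le> card (translates v K) * card Y" using * by (rule le_trans) simp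
      finally have "8 * x - 8 \<le> card (translates v K) * card Y" by simp
      then show ?thesis by (simp only: Y_def x_def)
    qed
  qed
qed

end

section \<open>Cosets of H under the unipotent radical, and the four types\<close>

context symplectic_F2_subgroup
begin

definition coset :: "('a \<Rightarrow> 'a) \<Rightarrow> ('a \<Rightarrow> 'a) set" where
  "coset f = (\<lambda>h. h \<circ> f) ` H"

definition idx :: nat where
  "idx = card (coset ` Isom)"

lemma coset_eq: "coset f = coset f' \<longleftrightarrow> (\<exists>h\<in>H. f' = h \<circ> f)"
proof
  assume "coset f = coset f'"
  moreover have "f' \<in> coset f'" using H_id by (auto simp: coset_def intro: image_eqI[of _ _ id])
  ultimately show "\<exists>h\<in>H. f' = h \<circ> f" by (auto simp: coset_def)
next
  assume "\<exists>h\<in>H. f' = h \<circ> f"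
  then obtain h where h: "h \<in> H" "f' = h \<circ> f" by blast
  have "k \<circ> f' \<in> coset f" if "k \<in> H" for k
    unfolding coset_def h(2) using H_comp[OF that h(1)] by (intro image_eqI[of _ _ "k \<circ> h"]) (auto simp: comp_assoc)
  moreover have "k \<circ> f \<in> coset f'" if "k \<in> H" for k
  proof -
    have "k \<circ> f = (k \<circ> ginv h) \<circ> f'"
      using Isom_inv_comp(1)[OF H_Isom[OF h(1)]] by (simp add: h(2) comp_assoc fun.map_comp[symmetric]) (metis comp_assoc id_comp)
    then show ?thesis unfolding coset_def using H_comp[OF that H_ginv[OF h(1)]] by blast
  qed
  ultimately show "coset f = coset f'" by (auto simp: coset_def)
qed

lemma idx_ge:
  assumes "\<And>f h. f \<in> Isom \<Longrightarrow> h \<in> H \<Longrightarrow> \<phi> (h \<circ> f) = \<phi> f"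
  shows "card (\<phi> ` Isom) \<le> idx"
proof -
  have "\<phi> f = \<phi> (SOME f'. f' \<in> coset f)" if "f \<in> Isom" for f
  proof -
    have "\<exists>f'. f' \<in> coset f" using H_id by (auto simp: coset_def)
    then have "(SOME f'. f' \<in> coset f) \<in> coset f" by (rule someI_ex)
    then show ?thesis using assms[OF that] by (auto simp: coset_def)
  qed
  then have "\<phi> ` Isom \<subseteq> (\<lambda>C. \<phi> (SOME f'. f' \<in> C)) ` coset ` Isom" by blast
  then have "card (\<phi> ` Isom) \<le> card ((\<lambda>C. \<phi> (SOME f'. f' \<in> C)) ` coset ` Isom)"
    by (intro card_mono finite_imageI) auto
  also have "\<dots> \<le> idx" unfolding idx_def by (rule card_image_le) simp
  finally show ?thesis .
qed

context
  fixes v :: 'a assumes v: "v \<noteq> 0"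
begin

text \<open>The intersection of \<open>H\<close> with the unipotent radical at \<open>v\<close>; every element is counted twice,
  because \<^term>\<open>unip v w e = unip v (w + v) e\<close>.\<close>

definition K where "K = {(w, e). \<not> om v w \<and> unip v w e \<in> H}"

definition Khat where "Khat = fst ` K"

lemma mem_Khat: "w \<in> Khat \<longleftrightarrow> \<not> om v w \<and> (\<exists>e. unip v w e \<in> H)"
  by (force simp: Khat_def K_def)

lemma Khat_subsp: "subsp Khat" "v \<in> Khat" "Khat \<subseteq> perp {0, v}"
proof -
  show "subsp Khat"
    unfolding subsp_def
  proof (intro conjI ballI)
    show "0 \<in> Khat" using H_id by (auto simp: mem_Khat unip_zero intro!: exI[of _ False])
    fix x y assume "x \<in> Khat" "y \<in> Khat"
    then obtain e e' where xy: "\<not> om v x" "\<not> om v y" "unip v x e \<in> H" "unip v y e' \<in> H" by (auto simp: mem_Khat)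
    then have "\<exists>e. unip v (x + y) e \<in> H" using unip_comp_mem[OF xy] by blast
    then show "x + y \<in> Khat" using xy(1,2) by (simp add: mem_Khat)
  qed
  show "v \<in> Khat" using H_id by (auto simp: mem_Khat unip_self intro!: exI[of _ False])
  show "Khat \<subseteq> perp {0, v}" by (auto simp: mem_Khat mem_perp1 om_sym)
qed

lemma Khat_invariant:
  assumes h: "h \<in> H" "h v = v" shows "h x \<in> Khat \<longleftrightarrow> x \<in> Khat"
proof -
  have "om v (h x) = om v x" using Isom_om[OF H_Isom[OF h(1)], of v x] h(2) by simp
  then show ?thesis using unip_image_iff[OF h(1), of v x] h(2) by (simp add: mem_Khat)
qed

text \<open>The radical acts trivially on v^perp modulo v, and the preimage of \<open>Khat\<close>
  under f lies between v and v^perp.\<close>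

lemma Khat_vimage_unip:
  assumes f: "f \<in> stab v" and w: "\<not> om v w"
  shows "(f \<circ> unip v w e) -` Khat = f -` Khat"
proof (intro Set.set_eqI)
  fix x
  have Isom: "f \<in> Isom" "f v = v" using f by (auto simp: stab_def)
  have "unip v w e x = x \<or> unip v w e x = v + x" if "\<not> om x v"
    using that by (auto simp: unip_def ac_simps)
  moreover have "f (v + x) \<in> Khat \<longleftrightarrow> f x \<in> Khat"
    using subsp_add_iff[OF Khat_subsp(1,2)] Isom_add[OF Isom(1)] Isom(2) by simp
  moreover have "f y \<notin> Khat" if "om y v" for y
    using stab_om[OF f, of y] that by (auto simp: mem_Khat om_sym)
  moreover have "om (unip v w e x) v = om x v" using stab_om(1)[OF unip_stab[OF w]] .
  ultimately show "x \<in> (f \<circ> unip v w e) -` Khat \<longleftrightarrow> x \<in> f -` Khat"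
    by (cases "om x v") auto
qed

text \<open>If H f u = H f u0 with u, u0 in the radical, then conjugating u u0 by f gives an element
  of H in the radical. Both the 4^g parameters and \<open>K\<close> list every element twice, so the
  factor cancels.\<close>

lemma card_cosets_unip:
  assumes f: "f \<in> stab v"
  shows "4 ^ g \<le> card ((\<lambda>(w, e). coset (f \<circ> unip v w e)) ` (perp {0, v} \<times> UNIV)) * card K"
proof -
  have Isom: "f \<in> Isom" "f v = v" using f by (auto simp: stab_def)
  have "4 ^ g = card (perp {0, v} \<times> (UNIV :: bool set))"
    using card_perp1[OF v] by (simp add: card_cartesian_product)
  also have "\<dots> \<le> card ((\<lambda>(w, e). coset (f \<circ> unip v w e)) ` (perp {0, v} \<times> UNIV)) * card K"
  proof (rule card_le_image_times)
    fix b :: "'a \<times> bool" assume b: "b \<in> perp {0, v} \<times> UNIV"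
    obtain w0 e0 where b': "b = (w0, e0)" by (cases b)
    have w0: "\<not> om v w0" using b b' by (auto simp: mem_perp1 om_sym)
    let ?S = "{a \<in> perp {0, v} \<times> UNIV. (case a of (w, e) \<Rightarrow> coset (f \<circ> unip v w e)) = (case b of (w, e) \<Rightarrow> coset (f \<circ> unip v w e))}"
    show "card ?S \<le> card K"
    proof (rule card_inj_on_le[of "\<lambda>(w, e). (f (w + w0), (e \<noteq> e0) \<noteq> om w w0)"])
      show "inj_on (\<lambda>(w, e). (f (w + w0), (e \<noteq> e0) \<noteq> om w w0)) ?S"
        by (rule inj_onI) (auto simp: Isom_eq_iff[OF Isom(1)])
      show "(\<lambda>(w, e). (f (w + w0), (e \<noteq> e0) \<noteq> om w w0)) ` ?S \<subseteq> K"
      proof (rule image_subsetI)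
        fix a assume a: "a \<in> ?S"
        obtain w e where a': "a = (w, e)" by (cases a)
        have w: "w \<in> perp {0, v}" and eq: "coset (f \<circ> unip v w e) = coset (f \<circ> unip v w0 e0)"
          using a by (auto simp: a' b')
        have w1: "\<not> om v w" using w by (auto simp: mem_perp1 om_sym)
        obtain h where h: "h \<in> H" "f \<circ> unip v w e = h \<circ> (f \<circ> unip v w0 e0)"
          using eq[symmetric] by (auto simp: coset_eq)
        have "unip v w0 e0 \<circ> unip v w0 e0 = id" using unip_inv[OF w0] by auto
        then have "f \<circ> unip v w e \<circ> unip v w0 e0 = h \<circ> f"
          unfolding h(2) by (metis comp_assoc comp_id)
        then have "f \<circ> unip v (w + w0) ((e \<noteq> e0) \<noteq> om w w0) = h \<circ> f"
          by (simp only: comp_assoc unip_comp[OF w1 w0])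
        then have "unip v (f (w + w0)) ((e \<noteq> e0) \<noteq> om w w0) \<circ> f = h \<circ> f"
          by (simp only: unip_conj[OF Isom(1)] Isom(2))
        then have "unip v (f (w + w0)) ((e \<noteq> e0) \<noteq> om w w0) = h"
          by (metis Isom(1) Isom_inv_comp(2) comp_assoc comp_id)
        moreover have "\<not> om v (f (w + w0))"
          using stab_om(2)[OF f] w1 w0 by simp
        ultimately have "(f (w + w0), (e \<noteq> e0) \<noteq> om w w0) \<in> K"
          using h(1) unfolding K_def by blast
        then show "(case a of (w, e) \<Rightarrow> (f (w + w0), (e \<noteq> e0) \<noteq> om w w0)) \<in> K"
          by (simp only: a' case_prod_conv)
      qed
    qed simp
  qed simp
  finally show ?thesis .
qed

text \<open>Cosets H f with f fixing v are sorted by the preimage of \<open>Khat\<close> under f. It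
  is constant on cosets, because the stabilizer of v in H preserves \<open>Khat\<close>, and on
  orbits of the radical, so each class contains a full orbit.\<close>

lemma idx_card_K: "card (translates v Khat) * 4 ^ g \<le> idx * card K"
  unfolding idx_def
proof (rule card_mult_disjoint_le)
  let ?A = "\<lambda>X. {c. \<exists>f\<in>stab v. c = coset f \<and> f -` Khat = X}"
  fix X assume X: "X \<in> translates v Khat"
  show "?A X \<subseteq> coset ` Isom" by (auto simp: stab_def)
  obtain f where f: "f \<in> stab v" "X = f -` Khat" using X by (auto simp: translates_def)
  have "(\<lambda>(w, e). coset (f \<circ> unip v w e)) ` (perp {0, v} \<times> UNIV) \<subseteq> ?A X"
  proof (rule image_subsetI)
    fix a assume a: "a \<in> perp {0, v} \<times> (UNIV :: bool set)"
    obtain w e where a': "a = (w, e)" by (cases a)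
    have w: "\<not> om v w" using a by (simp add: a' mem_perp1 om_sym)
    have "f \<circ> unip v w e \<in> stab v" by (rule stab_comp[OF f(1) unip_stab[OF w]])
    then show "(case a of (w, e) \<Rightarrow> coset (f \<circ> unip v w e)) \<in> ?A X"
      unfolding a' case_prod_conv mem_Collect_eq f(2) by (intro bexI[of _ "f \<circ> unip v w e"] conjI refl Khat_vimage_unip[OF f(1) w])
  qed
  then show "4 ^ g \<le> card (?A X) * card K"
    using card_cosets_unip[OF f(1)] by (meson card_mono finite le_trans mult_le_mono1)
  fix X' assume "X' \<in> translates v Khat" "X \<noteq> X'"
  moreover have "f -` Khat = f' -` Khat" if eq: "coset f = coset f'" and f: "f \<in> stab v" "f' \<in> stab v" for f f'
  proof -
    obtain h where h: "h \<in> H" "f' = h \<circ> f" using eq by (auto simp: coset_eq)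
    have "h v = v" using f h(2) by (auto simp: stab_def)
    then show ?thesis using Khat_invariant[OF h(1)] h(2) by auto
  qed
  ultimately show "?A X \<inter> ?A X' = {}" by blast
qed simp_all

text \<open>Every radical orbit now has at least 4^g / 2 cosets, because \<open>K\<close> lists only
  the identity, twice. If the conclusion failed, the orbits through H and H f would be disjoint and
  the index at least 4^g.\<close>

lemma isR_complement:
  assumes R: "isR v" and small: "idx < 4 ^ g" and f: "f \<in> Isom" "f v = v"
  shows "\<exists>w e. \<not> om v w \<and> f \<circ> unip v w e \<in> H"
proof (rule ccontr)
  assume n: "\<not> ?thesis"
  let ?C = "\<lambda>f. (\<lambda>(w, e). coset (f \<circ> unip v w e)) ` (perp {0, v} \<times> UNIV)"
  have "K \<subseteq> {(0, False), (v, False)}"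
  proof
    fix a assume "a \<in> K"
    then obtain w e where a: "a = (w, e)" "\<not> om v w" "unip v w e \<in> H" by (auto simp: K_def)
    then have "w = 0 \<or> w = v" using R unfolding isR_def by blast
    then show "a \<in> {(0, False), (v, False)}" using a R by (cases e) (auto simp: isR_def unip_zero unip_self)
  qed
  then have "card K \<le> card {(0::'a, False), (v, False)}" by (simp add: card_mono)
  then have K2: "card K \<le> 2" using v by simp
  have fs: "f \<in> stab v" "id \<in> stab v" using f by (auto simp: stab_def)
  have disj: "?C id \<inter> ?C f = {}"
  proof (rule ccontr)
    assume "?C id \<inter> ?C f \<noteq> {}"
    then obtain w e w' e' where w: "\<not> om v w" "\<not> om v w'" "coset (id \<circ> unip v w e) = coset (f \<circ> unip v w' e')"
      by (auto simp: mem_perp1 om_sym)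
    then obtain h where h: "h \<in> H" "f \<circ> unip v w' e' = h \<circ> unip v w e" by (auto simp: coset_eq)
    then have "f \<circ> unip v w' e' \<circ> unip v w e = h"
      using unip_inv[OF w(1)] by (auto simp: fun_eq_iff)
    then have "f \<circ> unip v (w' + w) ((e' \<noteq> e) \<noteq> om w' w) = h"
      by (simp only: comp_assoc unip_comp[OF w(2,1)])
    moreover have "\<not> om v (w' + w)" using w by simp
    ultimately show False using n h(1) by blast
  qed
  have "?C f' \<subseteq> coset ` Isom" if f': "f' \<in> Isom" for f'
  proof (rule image_subsetI)
    fix a assume a: "a \<in> perp {0, v} \<times> (UNIV :: bool set)"
    obtain w e where a': "a = (w, e)" by (cases a)
    have "\<not> om v w" using a by (simp add: a' mem_perp1 om_sym)
    then show "(case a of (w, e) \<Rightarrow> coset (f' \<circ> unip v w e)) \<in> coset ` Isom"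
      unfolding a' case_prod_conv by (intro imageI Isom_comp f' unip_in_Isom)
  qed
  then have "?C id \<union> ?C f \<subseteq> coset ` Isom" using f(1) Isom_id by (meson Un_least)
  then have "card (?C id \<union> ?C f) \<le> idx" unfolding idx_def by (simp add: card_mono)
  then have "card (?C id) + card (?C f) \<le> idx" by (simp only: card_Un_disjoint[OF finite finite disj])
  then have "card (?C id) * 2 + card (?C f) * 2 \<le> idx * 2" by simp
  moreover have "4 ^ g \<le> card (?C id) * 2" "4 ^ g \<le> card (?C f) * 2"
    using card_cosets_unip[OF fs(2)] card_cosets_unip[OF fs(1)] K2 by (meson le_trans mult_le_mono2)+
  ultimately show False using small by linarith
qed

text \<open>Let t be the number of translates of \<open>Khat\<close>. Unless \<open>Khat\<close> is
  {0, v}, the thresholds for t |Y| leave |Y| <= 4 if the transvection at v is in H, giving type F,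
  and |Y| = 2 otherwise, giving type M.\<close>

lemma point_types:
  assumes small: "idx + 4 < 4 ^ g"
  shows "isF v \<or> isN v \<or> isM v \<or> isR v"
proof -
  define x where "x = (4::nat) ^ (g - 1)"
  have x: "4 * x = 4 ^ g" using g_ge_3 by (simp add: x_def flip: power_Suc)
  define Y where "Y = perp Khat"
  have Y: "subsp Y" "perp Y = Khat"
    using subsp_perp perp_perp[OF Khat_subsp(1)] by (auto simp: Y_def)
  have 0: "{0, v} \<subseteq> Y" "{0, v} \<subseteq> Khat"
    using subsp_zero_mem[OF Y(1)] subsp_zero_mem[OF Khat_subsp(1)] Khat_subsp by (auto simp: Y_def perp_def mem_perp1 om_sym subset_iff)
  have KY: "card Khat * card Y = 4 ^ g" using card_perp[OF Khat_subsp(1)] by (simp add: Y_def)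
  have Kpos: "card Khat > 0" using card_subsp_pos[OF Khat_subsp(1)] .
  \<comment> \<open>Used with c = 2 if \<open>transv v\<close> is in H, where both values of the
    second parameter may occur, and with c = 1 otherwise.\<close>
  have cancel: "card (translates v Khat) * card Y \<le> idx * c" if "card K \<le> c * card Khat" for c
  proof -
    have "(card (translates v Khat) * card Y) * card Khat = card (translates v Khat) * 4 ^ g"
      by (simp only: KY[symmetric] ac_simps)
    also have "\<dots> \<le> idx * card K" by (rule idx_card_K)
    also have "\<dots> \<le> (idx * c) * card Khat" using that by simp
    finally show ?thesis using Kpos by simp
  qed
  obtain k where k: "card Y = 2 ^ k" using card_subsp_power[OF Y(1)] by blast
  have "k = 1 \<or> k = 2 \<or> 3 \<le> k"
    using card_mono[OF _ 0(1)] v k by (cases k) auto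
  moreover have "8 \<le> card Y" if "3 \<le> k" using power_increasing[OF that, of "2::nat"] k by simp
  ultimately have cY: "card Y = 2 \<or> card Y = 4 \<or> 8 \<le> card Y" using k by auto
  have Y2: "Y = {0, v}" if "card Y = 2"
    using card_subset_eq[of Y "{0, v}"] 0 that v by simp
  show ?thesis
  proof (cases "Khat = {0, v}")
    case True
    then have "w = 0 \<or> w = v" if "\<not> om v w" "unip v w e \<in> H" for w e using mem_Khat that by blast
    then show ?thesis unfolding isN_def isR_def by blast
  next
    case False
    note big = card_translates_times_perp[OF v Khat_subsp False, folded Y_def]
    show ?thesis
    proof (cases "transv v \<in> H")
      case True
      have "card K \<le> card (Khat \<times> (UNIV :: bool set))"
        by (intro card_mono) (auto simp: Khat_def intro: rev_image_eqI)
      then have "card (translates v Khat) * card Y \<le> idx * 2" by (intro cancel) (simp add: card_cartesian_product)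
      then have "card Y = 2 \<or> card Y = 4" using cY big small x by (auto simp: x_def)
      then have "\<exists>y. \<not> om v y \<and> Y \<subseteq> {0, v, y, v + y} \<and> y \<in> Y"
      proof
        assume "card Y = 4"
        then have "Y \<noteq> {0, v}" using v by auto
        then obtain y where y: "y \<in> Y" "y \<noteq> 0" "y \<noteq> v" using 0 by blast
        have "v + y \<in> Y" using subspD[OF Y(1)] 0 y by blast
        then have "{0, v, y, v + y} \<subseteq> Y" using 0 y by blast
        moreover have "card {0, v, y, v + y} = 4" using v y by (auto simp: add_eq_0_iff_eq)
        ultimately have "Y = {0, v, y, v + y}" using \<open>card Y = 4\<close> card_subset_eq[of Y "{0, v, y, v + y}"] by simp
        moreover have "\<not> om v y" using y 0 by (auto simp: Y_def perp_def om_sym)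
        ultimately show ?thesis using y by blast
      qed (use Y2 in \<open>auto intro: exI[of _ v]\<close>)
      then obtain y where y: "\<not> om v y" "Y \<subseteq> {0, v, y, v + y}" "y \<in> Y" by blast
      have "unip v w False \<in> H \<longleftrightarrow> \<not> om w y" if w: "\<not> om v w" for w
      proof -
        have "unip v w False \<in> H \<longleftrightarrow> w \<in> Khat"
          using w unip_False_iff_unip_True[OF w True] by (auto simp: mem_Khat) (metis (full_types))
        also have "\<dots> \<longleftrightarrow> w \<in> perp Y" using Y by simp
        also have "\<dots> \<longleftrightarrow> \<not> om w y" using y w by (auto simp: perp_def om_sym)
        finally show ?thesis .
      qed
      then show ?thesis using True y unfolding isF_def by blast
    next
      case False
      have "inj_on fst K"
      proof (rule inj_onI, clarsimp simp: K_def)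
        fix w e e' assume "\<not> om v w" "unip v w e \<in> H" "unip v w e' \<in> H"
        then show "e = e'" using unip_both_imp_transv[of v w] False by (cases e; cases e') auto
      qed
      then have "card K = card Khat" by (simp add: Khat_def card_image)
      then have "card (translates v Khat) * card Y \<le> idx * 1" by (intro cancel) simp
      then have "card Y = 2" using cY big small x by (auto simp: x_def)
      then have "Khat = perp {0, v}" using Y2 Y by simp
      then show ?thesis using False mem_Khat mem_perp1 om_sym unfolding isM_def by (metis (full_types))
    qed
  qed
qed

end

theorem small_index_cases:
  assumes small: "idx + 4 < 4 ^ g"
  shows "H = Isom \<or> (\<exists>q. quad q \<and> (\<forall>f\<in>H. \<forall>x. q (f x) = q x)) \<or> (\<exists>z. z \<noteq> 0 \<and> (\<forall>f\<in>H. f z = z))"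
proof -
  have types: "\<And>v. v \<noteq> 0 \<Longrightarrow> isF v \<or> isN v \<or> isM v \<or> isR v"
    using point_types small by blast
  have small': "idx < 4 ^ g" using small by simp
  show ?thesis
  proof (cases "\<exists>v. v \<noteq> 0 \<and> isR v")
    case True
    define S where "S = {v. v \<noteq> 0 \<and> isR v}"
    have "(\<exists>q. quad q \<and> (\<forall>f\<in>H. \<forall>x. q (f x) = q x)) \<or> (\<exists>z. z \<noteq> 0 \<and> (\<forall>f\<in>H. f z = z))"
    proof (rule invariant_form_or_vector[of S])
      show "0 \<notin> S" "S \<noteq> {}" using True by (auto simp: S_def)
      show "f x \<in> S" if "f \<in> H" "x \<in> S" for f x
        using that(2) isR_image[OF that(1)] Isom_eq_0_iff[OF H_Isom[OF that(1)]] by (auto simp: S_def)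
      show "w \<in> S \<longleftrightarrow> v + w \<notin> S" if "v \<in> S" "\<not> om v w" "w \<noteq> 0" "w \<noteq> v" for v w
      proof -
        have v: "v \<noteq> 0" "isR v" using that(1) by (auto simp: S_def)
        have "isR w \<noteq> isR (v + w)"
          by (rule R_plane[OF types v that(2,3,4)], assumption) (rule isR_complement[OF v small'])
        then show ?thesis using that(3,4) by (auto simp: S_def add_eq_0_iff_eq)
      qed
    qed
    then show ?thesis by blast
  next
    case False
    then have noR: "\<And>v. v \<noteq> 0 \<Longrightarrow> \<not> isR v" by blast
    show ?thesis
    proof (cases "\<exists>v. v \<noteq> 0 \<and> isF v")
      case True
      then have "transv c \<in> H" for c using F_transvections[OF types noR] by blast
      then show ?thesis using generated_by_transvections by blast
    next
      case False
      then have noF: "\<And>v. v \<noteq> 0 \<Longrightarrow> \<not> isF v" by blast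
      define S where "S = {v. v \<noteq> 0 \<and> transv v \<in> H}"
      have "(\<exists>q. quad q \<and> (\<forall>f\<in>H. \<forall>x. q (f x) = q x)) \<or> (\<exists>z. z \<noteq> 0 \<and> (\<forall>f\<in>H. f z = z))"
      proof (rule invariant_form_or_vector[of S])
        show "0 \<notin> S" "S \<noteq> {}" using ex_transv_mem[OF types noR] by (auto simp: S_def)
        show "f x \<in> S" if "f \<in> H" "x \<in> S" for f x
          using that(2) transv_image_iff[OF that(1)] Isom_eq_0_iff[OF H_Isom[OF that(1)]] by (auto simp: S_def)
        show "w \<in> S \<longleftrightarrow> v + w \<notin> S" if "v \<in> S" "\<not> om v w" "w \<noteq> 0" "w \<noteq> v" for v w
        proof -
          have v: "v \<noteq> 0" "transv v \<in> H" using that(1) by (auto simp: S_def)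
          have "transv w \<in> H \<longleftrightarrow> transv (v + w) \<notin> H"
            by (rule N_plane[OF types noR noF v that(2,3,4)])
          then show ?thesis using that(3,4) by (auto simp: S_def add_eq_0_iff_eq)
        qed
      qed
      then show ?thesis by blast
    qed
  qed
qed

end

section \<open>Quadratic forms\<close>

lemma card_image_eq_of_same_fibres:
  assumes "\<And>x y. x \<in> A \<Longrightarrow> y \<in> A \<Longrightarrow> F x = F y \<longleftrightarrow> E x = E y"
  shows "card (F ` A) = card (E ` A)"
proof (rule bij_betw_same_card[of "\<lambda>c. E (inv_into A F c)"], rule bij_betw_imageI)
  have *: "E (inv_into A F (F x)) = E x" if "x \<in> A" for x
    using assms[of "inv_into A F (F x)" x] that by (simp add: inv_into_into f_inv_into_f)
  show "inj_on (\<lambda>c. E (inv_into A F c)) (F ` A)"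
    by (rule inj_onI) (auto simp: * assms)
  show "(\<lambda>c. E (inv_into A F c)) ` F ` A = E ` A"
    using * by (force simp: image_image)
qed

context symplectic_F2
begin

lemma quad_add: "quad q \<Longrightarrow> q (x + y) \<longleftrightarrow> (q x \<noteq> q y) \<noteq> om x y"
  by (simp add: quad_def)

lemma quad_0: "quad q \<Longrightarrow> \<not> q 0"
  using quad_add[of q 0 0] by simp

text \<open>A form on a subspace of greatest cardinality is extended by the value
  \<open>False\<close> at a new vector \<open>c\<close>; polarization then dictates the values on c
  + S.\<close>

lemma ex_quad: "\<exists>q. quad q"
proof -
  define P where "P S q \<longleftrightarrow> (\<forall>x\<in>S. \<forall>y\<in>S. q (x + y) \<longleftrightarrow> (q x \<noteq> q y) \<noteq> om x y)" for S and q :: "'a \<Rightarrow> bool"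
  have "P {0} (\<lambda>_. False)" "subsp {0}" by (auto simp: P_def subsp_def)
  then obtain S q where S: "subsp S" "P S q"
    and max: "\<And>S' q'. subsp S' \<Longrightarrow> P S' q' \<Longrightarrow> card S' \<le> card S"
    using ex_has_greatest_nat[of "\<lambda>(S, q). subsp S \<and> P S q" "({0}, \<lambda>_. False)" "\<lambda>(S, q). card S" "Suc (CARD('a))"]
    by (auto simp: card_mono less_Suc_eq_le)
  have "S = UNIV"
  proof (rule ccontr)
    assume "S \<noteq> UNIV"
    then obtain c where c: "c \<notin> S" by blast
    define S' where "S' = S \<union> (+) c ` S"
    define q' where "q' x \<longleftrightarrow> (if x \<in> S then q x else q (c + x) \<noteq> om c (c + x))" for x
    have in1: "c + x \<notin> S" if "x \<in> S" for x using that c subsp_add_iff[OF S(1) that, of c] by (simp add: add.commute)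
    have q'1: "q' x = q x" and q'2: "q' (c + x) = (q x \<noteq> om c x)" if "x \<in> S" for x
      using that in1[OF that] by (simp_all add: q'_def)
    have q: "q (x + y) \<longleftrightarrow> (q x \<noteq> q y) \<noteq> om x y" if "x \<in> S" "y \<in> S" for x y
      using S(2) that by (simp add: P_def)
    have "q' (x + y) \<longleftrightarrow> (q' x \<noteq> q' y) \<noteq> om x y" if xy: "x \<in> S'" "y \<in> S'" for x y
    proof -
      have add: "a + b \<in> S" if "a \<in> S" "b \<in> S" for a b using subspD[OF S(1)] that by blast
      have 1: "q' (a + b) \<longleftrightarrow> (q' a \<noteq> q' b) \<noteq> om a b" if "a \<in> S" "b \<in> S" for a b
        using q[OF that] q'1 add that by simp
      have 2: "q' ((c + a) + b) \<longleftrightarrow> (q' (c + a) \<noteq> q' b) \<noteq> om (c + a) b" if "a \<in> S" "b \<in> S" for a b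
        using q[OF that] q'1[OF that(2)] q'2[OF that(1)] q'2[OF add[OF that]] by (auto simp: add.assoc)
      have 3: "q' ((c + a) + (c + b)) \<longleftrightarrow> (q' (c + a) \<noteq> q' (c + b)) \<noteq> om (c + a) (c + b)" if "a \<in> S" "b \<in> S" for a b
        using q[OF that] q'1[OF add[OF that]] q'2[OF that(1)] q'2[OF that(2)] om_sym[of a c] by (auto simp: ac_simps)
      show ?thesis
        using xy 1 3 2[of _ x] 2[of _ y] unfolding S'_def
        by (elim UnE imageE) (simp_all only:, metis add.commute om_sym)
    qed
    then have "card S' \<le> card S" using max[of S' q'] subsp_extend[OF S(1)] by (simp add: P_def S'_def)
    moreover have "c \<in> S'" using subsp_zero_mem[OF S(1)] by (auto simp: S'_def image_iff)
    then have "card S < card S'" using c by (intro psubset_card_mono) (auto simp: S'_def)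
    ultimately show False by simp
  qed
  then have "quad q" using S(2) by (simp add: P_def quad_def)
  then show ?thesis by blast
qed

text \<open>The Gauss sum of q; its sign is the Arf invariant.\<close>

definition sign_sum :: "('a \<Rightarrow> bool) \<Rightarrow> int" where
  "sign_sum q = (\<Sum>x\<in>UNIV. if q x then -1 else 1)"

definition zeros :: "('a \<Rightarrow> bool) \<Rightarrow> 'a set" where
  "zeros q = {x. \<not> q x}"

definition singular :: "('a \<Rightarrow> bool) \<Rightarrow> 'a set \<Rightarrow> bool" where
  "singular q S \<longleftrightarrow> subsp S \<and> (\<forall>x\<in>S. \<not> q x)"

lemma singular_perp:
  assumes q: "quad q" and S: "singular q S" shows "S \<subseteq> perp S"
  using quad_add[OF q] S unfolding singular_def subsp_def perp_def by blast

text \<open>Averaging over translations by \<open>S\<close> multiplies the term at x by the mean of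
  the signs of \<open>om s x\<close>, which vanishes outside \<open>perp S\<close>.\<close>

lemma sign_sum_singular:
  assumes q: "quad q" and S: "singular q S"
  shows "sign_sum q = (\<Sum>x\<in>perp S. if q x then -1 else 1)"
proof -
  have sub: "subsp S" and z: "\<And>x. x \<in> S \<Longrightarrow> \<not> q x" using S by (auto simp: singular_def)
  let ?s = "\<lambda>b. if b then -1 else 1 :: int"
  have "int (card S) * sign_sum q = (\<Sum>s\<in>S. \<Sum>x\<in>UNIV. ?s (q x))" by (simp add: sign_sum_def)
  also have "\<dots> = (\<Sum>s\<in>S. \<Sum>x\<in>UNIV. ?s (q (s + x)))"
  proof (rule sum.cong[OF refl])
    fix s
    show "(\<Sum>x\<in>UNIV. ?s (q x)) = (\<Sum>x\<in>UNIV. ?s (q (s + x)))"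
      by (rule sum.reindex_bij_witness[where i="\<lambda>x. s + x" and j="\<lambda>x. s + x"]) auto
  qed
  also have "\<dots> = (\<Sum>x\<in>UNIV. \<Sum>s\<in>S. ?s (q (s + x)))" by (rule sum.swap)
  also have "\<dots> = (\<Sum>x\<in>UNIV. ?s (q x) * (\<Sum>s\<in>S. ?s (om s x)))"
    unfolding sum_distrib_left
    by (intro sum.cong refl) (use z in \<open>auto simp: quad_add[OF q]\<close>)
  also have "\<dots> = (\<Sum>x\<in>UNIV. if x \<in> perp S then ?s (q x) * int (card S) else 0)"
    by (rule sum.cong[OF refl], subst sum_signs_additive[OF sub]) (auto simp: perp_def om_sym)
  also have "\<dots> = (\<Sum>x\<in>perp S. ?s (q x) * int (card S))"
    by (simp only: sum.inter_restrict[symmetric] finite Int_UNIV_left)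
  also have "\<dots> = int (card S) * (\<Sum>x\<in>perp S. ?s (q x))"
    by (subst sum_distrib_right[symmetric]) (rule mult.commute)
  finally show ?thesis using card_subsp_pos[OF sub] by (auto simp: card_gt_0_iff)
qed

lemma singular_extend:
  assumes q: "quad q" and S: "singular q S" and x: "x \<in> perp S" "\<not> q x"
  shows "singular q (S \<union> (+) x ` S)"
  using S x subsp_extend[of S x] by (auto simp: singular_def quad_add[OF q] perp_def)

text \<open>The form induced on \<open>perp S\<close> modulo \<open>S\<close> is anisotropic, which
  over F_2 forces dimension at most 2. As q vanishes on \<open>perp S\<close> exactly at the points
  of \<open>S\<close>, the sign sum is 2 |S| - |perp S|.\<close>

lemma maximal_singular:
  assumes q: "quad q" and S: "singular q S"
    and max: "\<And>x. x \<in> perp S \<Longrightarrow> \<not> q x \<Longrightarrow> x \<in> S"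
  shows "card S = 2 ^ g \<and> sign_sum q = 2 ^ g \<or> card S = 2 ^ (g - 1) \<and> sign_sum q = - (2 ^ g)"
proof -
  have sub: "subsp S" using S by (simp add: singular_def)
  obtain k where k: "card S = 2 ^ k" using card_subsp_power[OF sub] by blast
  obtain j where j: "card (perp S) = 2 ^ j" using card_subsp_power[OF subsp_perp[of S]] by blast
  have "(2::nat) ^ (k + j) = 2 ^ (2 * g)" using card_perp[OF sub] k j by (simp add: power_add power_mult)
  then have kj: "k + j = 2 * g" by (simp only: power_inject_exp)
  have "card S \<le> card (perp S)" using singular_perp[OF q S] by (simp add: card_mono)
  then have "k \<le> j" using k j by simp
  \<comment> \<open>In larger dimension there are orthogonal x and y in \<open>perp S\<close>,
    independent modulo \<open>S\<close>; both have value 1, so their sum is a zero of q outside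
    \<open>S\<close>.\<close>
  have "j \<le> k + 2"
  proof (rule ccontr)
    assume n: "\<not> j \<le> k + 2"
    then have "card S < card (perp S)" using k j by simp
    then obtain x where x: "x \<in> perp S" "x \<notin> S" using card_mono[of S "perp S"] by (meson finite not_less subsetI)
    define S' where "S' = S \<union> (+) x ` S"
    have S': "subsp S'" unfolding S'_def by (rule subsp_extend[OF sub])
    have c': "card S' \<le> 2 ^ (k + 1)" using card_extend[of S x] k by (simp add: S'_def)
    have "(2::nat) ^ (2 * g) = card S' * card (perp S')" using card_perp[OF S'] by (simp add: power_mult)
    also have "\<dots> \<le> 2 ^ (k + 1) * card (perp S')" using c' by (rule mult_le_mono1)
    finally have "(2::nat) ^ (2 * g) \<le> 2 ^ (k + 1) * card (perp S')" .
    moreover have "card (perp S') < 2 ^ (j - 1)" if "perp S' \<subseteq> S'"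
    proof -
      have "card (perp S') \<le> 2 ^ (k + 1)" using card_mono[OF _ that] c' by simp
      also have "\<dots> < (2::nat) ^ (j - 1)" using n by (intro power_strict_increasing) auto
      finally show ?thesis .
    qed
    moreover have "2 * g = (k + 1) + (j - 1)" using kj n by simp
    then have "(2::nat) ^ (2 * g) = 2 ^ (k + 1) * 2 ^ (j - 1)" by (simp only: power_add)
    ultimately have "\<not> perp S' \<subseteq> S'" by (metis mult_less_cancel1 not_less zero_less_numeral zero_less_power)
    then obtain y where y: "y \<in> perp S'" "y \<notin> S'" by blast
    have yS: "y \<in> perp S" "\<not> om y x" using y subsp_zero_mem[OF sub] by (auto simp: S'_def perp_def)
    have yn: "y \<notin> S" "x + y \<notin> S"
      using y by (auto simp: S'_def) (metis UnI2 dbl_left imageI)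
    have "q x" "q y" using max x yS yn by blast+
    then have "\<not> q (x + y)" using yS quad_add[OF q] by (simp add: om_sym)
    moreover have "x + y \<in> perp S" using subspD[OF subsp_perp x(1) yS(1)] .
    ultimately show False using max yn by blast
  qed
  then have "k = g \<and> j = g \<or> k = g - 1 \<and> j = g + 1" using \<open>k \<le> j\<close> kj g_ge_3 by presburger
  moreover have "sign_sum q = 2 * 2 ^ k - 2 ^ j"
  proof -
    have "sign_sum q = (\<Sum>x\<in>perp S. if q x then -1 else 1)" by (rule sign_sum_singular[OF q S])
    also have "\<dots> = (\<Sum>x\<in>perp S. if x \<in> S then 1 else -1)"
      using max S by (intro sum.cong) (auto simp: singular_def)
    also have "\<dots> = int (card S) - (int (card (perp S)) - int (card S))"
      using singular_perp[OF q S] by (simp add: sum.If_cases Int_absorb1 Diff_eq[symmetric] card_Diff_subset of_nat_diff card_mono)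
    finally show ?thesis by (simp add: k j)
  qed
  moreover have "(2::int) ^ g = 2 * 2 ^ (g - 1)" using g_ge_3 by (simp flip: power_Suc)
  ultimately show ?thesis using k by auto
qed

lemma maximal_singular_exists:
  assumes q: "quad q"
  obtains S where "singular q S" "\<And>S'. singular q S' \<Longrightarrow> card S' \<le> card S"
    "card S = 2 ^ g \<and> sign_sum q = 2 ^ g \<or> card S = 2 ^ (g - 1) \<and> sign_sum q = - (2 ^ g)"
proof -
  have "singular q {0}" using quad_0[OF q] by (simp add: singular_def subsp_def)
  then obtain S where S: "singular q S" and max: "\<And>S'. singular q S' \<Longrightarrow> card S' \<le> card S"
    using ex_has_greatest_nat[of "singular q" "{0}" card "Suc (CARD('a))"] by (auto simp: card_mono less_Suc_eq_le)
  have "x \<in> S" if "x \<in> perp S" "\<not> q x" for x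
  proof (rule ccontr)
    assume n: "x \<notin> S"
    have "x \<in> S \<union> (+) x ` S" using S by (auto simp: singular_def subsp_def image_iff)
    then have "card S < card (S \<union> (+) x ` S)" using n by (intro psubset_card_mono) auto
    then show False using max[OF singular_extend[OF q S that]] by simp
  qed
  then show thesis using that[OF S max] maximal_singular[OF q S] by blast
qed

lemma sign_sum_cases: "quad q \<Longrightarrow> sign_sum q = 2 ^ g \<or> sign_sum q = - (2 ^ g)"
  using maximal_singular_exists by metis

lemma sign_sum_zeros: "sign_sum q = 2 * int (card (zeros q)) - 4 ^ g"
proof -
  have "sign_sum q = int (card (zeros q)) - int (card {x. q x})"
    by (simp add: sign_sum_def sum.If_cases zeros_def Collect_neg_eq)
  moreover have "card (zeros q) + card {x. q x} = card (zeros q \<union> {x. q x})"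
    by (rule card_Un_disjoint[symmetric]) (auto simp: zeros_def)
  moreover have "zeros q \<union> {x. q x} = UNIV" by (auto simp: zeros_def)
  ultimately have "sign_sum q = int (card (zeros q)) - int (card {x. q x})"
      "int (card (zeros q)) + int (card {x. q x}) = 4 ^ g"
    using card_UNIV by (simp_all flip: of_nat_add)
  then show ?thesis by linarith
qed

definition shift :: "('a \<Rightarrow> bool) \<Rightarrow> 'a \<Rightarrow> 'a \<Rightarrow> bool" where
  "shift q a x \<longleftrightarrow> q x \<noteq> om x a"

lemma quad_shift: "quad q \<Longrightarrow> quad (shift q a)"
  by (auto simp: quad_def shift_def)

lemma quad_shift_ex:
  assumes "quad q" "quad q'" shows "\<exists>a. q' = shift q a"
proof -
  have "\<exists>z. \<forall>x. (q x \<noteq> q' x) \<longleftrightarrow> om x z"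
    by (rule functional_rep) (use assms in \<open>auto simp: quad_def\<close>)
  then show ?thesis by (auto simp: shift_def fun_eq_iff)
qed

lemma shift_inj: "shift q a = shift q b \<Longrightarrow> a = b"
  using om_ext[of a b] by (auto simp: shift_def fun_eq_iff om_sym)

lemma sign_sum_shift:
  assumes q: "quad q" shows "sign_sum (shift q a) = (if q a then - sign_sum q else sign_sum q)"
proof -
  have "sign_sum (shift q a) = (\<Sum>x\<in>UNIV. (if q a then -1 else 1) * (if q (a + x) then -1 else 1))"
    unfolding sign_sum_def by (intro sum.cong) (auto simp: shift_def quad_add[OF q] om_sym)
  also have "\<dots> = (if q a then -1 else 1) * (\<Sum>x\<in>UNIV. if q (a + x) then -1 else 1)"
    by (simp add: sum_distrib_left)
  also have "(\<Sum>x\<in>UNIV. if q (a + x) then -1 else 1) = sign_sum q"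
    unfolding sign_sum_def by (rule sum.reindex_bij_witness[where i="\<lambda>x. a + x" and j="\<lambda>x. a + x"]) auto
  finally show ?thesis by simp
qed

lemma shift_eq_comp_transv: "quad q \<Longrightarrow> \<not> q a \<Longrightarrow> shift q a = q \<circ> transv a"
  by (auto simp: shift_def transv_def fun_eq_iff quad_add)

lemma quad_comp: "quad q \<Longrightarrow> f \<in> Isom \<Longrightarrow> quad (q \<circ> f)"
  by (simp add: quad_def Isom_add Isom_om)

lemma sign_sum_comp:
  assumes f: "f \<in> Isom" shows "sign_sum (q \<circ> f) = sign_sum q"
  unfolding sign_sum_def
  by (rule sum.reindex_bij_witness[where i="ginv f" and j=f]) (auto simp: Isom_inv_f[OF f] Isom_f_inv[OF f])

lemma same_sign_sum_shift:
  assumes q: "quad q" and q': "quad q'" and eq: "sign_sum q' = sign_sum q"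
  shows "\<exists>a. \<not> q a \<and> q' = shift q a"
proof -
  obtain a where a: "q' = shift q a" using quad_shift_ex[OF q q'] by blast
  have "\<not> q a" using sign_sum_shift[OF q, of a] eq a sign_sum_cases[OF q] by auto
  then show ?thesis using a by blast
qed

lemma orbit_quad:
  assumes q: "quad q" shows "(\<lambda>f. q \<circ> f) ` Isom = shift q ` zeros q"
proof (intro Set.set_eqI iffI)
  fix q' assume "q' \<in> (\<lambda>f. q \<circ> f) ` Isom"
  then obtain f where f: "f \<in> Isom" "q' = q \<circ> f" by blast
  then show "q' \<in> shift q ` zeros q"
    using same_sign_sum_shift[OF q quad_comp[OF q f(1)] sign_sum_comp[OF f(1)]] by (auto simp: zeros_def)
next
  fix q' assume "q' \<in> shift q ` zeros q"
  then obtain a where "\<not> q a" "q' = shift q a" by (auto simp: zeros_def)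
  then show "q' \<in> (\<lambda>f. q \<circ> f) ` Isom" using shift_eq_comp_transv[OF q] transv_in_Isom by blast
qed

lemma card_orbit_quad: "quad q \<Longrightarrow> card ((\<lambda>f. q \<circ> f) ` Isom) = card (zeros q)"
  by (simp add: orbit_quad card_image inj_on_def) (metis card_image inj_onI shift_inj)

definition stabQ :: "('a \<Rightarrow> bool) \<Rightarrow> ('a \<Rightarrow> 'a) set" where
  "stabQ q = {f \<in> Isom. \<forall>x. q (f x) = q x}"

lemma stabQ_iff: "f \<in> stabQ q \<longleftrightarrow> f \<in> Isom \<and> q \<circ> f = q"
  by (auto simp: stabQ_def fun_eq_iff)

lemma stabQ_subgroup: "symplectic_F2_subgroup om g (stabQ q)"
proof unfold_locales
  show "stabQ q \<subseteq> Isom" by (auto simp: stabQ_def)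
  show "id \<in> stabQ q" by (simp add: stabQ_iff)
  show "f \<circ> h \<in> stabQ q" if "f \<in> stabQ q" "h \<in> stabQ q" for f h
    using that by (auto simp: stabQ_def)
  show "ginv f \<in> stabQ q" if "f \<in> stabQ q" for f
  proof -
    have f: "f \<in> Isom" "q \<circ> f = q" using that by (auto simp: stabQ_iff)
    have "q \<circ> ginv f = q" using f Isom_inv_comp(2)[OF f(1)] by (metis comp_assoc comp_id)
    then show ?thesis using f by (simp add: stabQ_iff)
  qed
qed

lemma stabQ_index:
  assumes q: "quad q" shows "symplectic_F2_subgroup.idx om (stabQ q) = card (zeros q)"
proof -
  interpret S: symplectic_F2_subgroup om g "stabQ q" by (rule stabQ_subgroup)
  have "S.coset f = S.coset f' \<longleftrightarrow> q \<circ> f = q \<circ> f'" if f: "f \<in> Isom" "f' \<in> Isom" for f f'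
  proof
    assume "S.coset f = S.coset f'"
    then obtain h where "h \<in> stabQ q" "f' = h \<circ> f" by (auto simp: S.coset_eq)
    then show "q \<circ> f = q \<circ> f'" by (auto simp: stabQ_iff comp_assoc[symmetric])
  next
    assume eq: "q \<circ> f = q \<circ> f'"
    have "q \<circ> (f' \<circ> ginv f) = q" using eq Isom_inv_comp(2)[OF f(1)] by (metis comp_assoc comp_id)
    then have "f' \<circ> ginv f \<in> stabQ q" using f by (simp add: stabQ_iff)
    moreover have "f' = (f' \<circ> ginv f) \<circ> f" using Isom_inv_comp(1)[OF f(1)] by (metis comp_assoc comp_id)
    ultimately show "S.coset f = S.coset f'" using S.coset_eq by blast
  qed
  then have "S.idx = card ((\<lambda>f. q \<circ> f) ` Isom)"
    unfolding S.idx_def by (intro card_image_eq_of_same_fibres) auto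
  then show ?thesis by (simp add: card_orbit_quad[OF q])
qed

lemma card_zeros:
  assumes q: "quad q"
  shows "card (zeros q) = (if sign_sum q = 2 ^ g then 2 ^ (g - 1) * (2 ^ g + 1) else 2 ^ (g - 1) * (2 ^ g - 1))"
proof -
  have 2: "(2::int) ^ g = 2 * 2 ^ (g - 1)" using g_ge_3 by (simp flip: power_Suc)
  have 4: "(4::int) ^ g = 2 ^ g * 2 ^ g" by (simp flip: power_mult_distrib)
  have z: "2 * int (card (zeros q)) = sign_sum q + 4 ^ g" using sign_sum_zeros[of q] by simp
  show ?thesis
  proof (cases "sign_sum q = 2 ^ g")
    case True
    then have "2 * int (card (zeros q)) = 2 ^ g * (2 ^ g + 1)" using z 4 by (simp add: algebra_simps)
    then have "2 * int (card (zeros q)) = 2 * (2 ^ (g - 1) * (2 ^ g + 1))"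
      by (simp only: 2[symmetric] mult.assoc[symmetric])
    then have "int (card (zeros q)) = 2 ^ (g - 1) * (2 ^ g + 1)" by linarith
    also have "\<dots> = int (2 ^ (g - 1) * (2 ^ g + 1))"
      by (simp only: of_nat_mult of_nat_add of_nat_power of_nat_numeral of_nat_1)
    finally show ?thesis using True by (simp only: of_nat_eq_iff refl if_True)
  next
    case False
    then have "2 * int (card (zeros q)) = 2 ^ g * (2 ^ g - 1)"
      using z 4 sign_sum_cases[OF q] by (simp add: algebra_simps)
    then have "2 * int (card (zeros q)) = 2 * (2 ^ (g - 1) * (2 ^ g - 1))"
      by (simp only: 2[symmetric] mult.assoc[symmetric])
    then have "int (card (zeros q)) = 2 ^ (g - 1) * (2 ^ g - 1)" by linarith
    also have "\<dots> = int (2 ^ (g - 1) * (2 ^ g - 1))"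
      by (simp add: of_nat_diff algebra_simps)
    finally show ?thesis using False by (simp only: of_nat_eq_iff if_False)
  qed
qed

text \<open>A form without nonzero values would polarize to zero; shifting by some \<open>a\<close>
  with \<open>q a\<close> reverses the sign.\<close>

lemma both_signs_occur:
  "\<exists>q. quad q \<and> sign_sum q = 2 ^ g" "\<exists>q. quad q \<and> sign_sum q = - (2 ^ g)"
proof -
  obtain q where q: "quad q" using ex_quad by blast
  have "\<exists>a. q a"
  proof (rule ccontr)
    assume "\<not> ?thesis"
    then have "\<not> om x y" for x y using quad_add[OF q, of x y] by blast
    then have "card {0 :: 'a} = 4 ^ g" using om_nondegenerate card_UNIV by (metis UNIV_eq_I singleton_iff)
    then show False using g_ge_3 one_less_power[of "4::nat" g] by simp
  qed
  then obtain a where "q a" by blast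
  then have "sign_sum (shift q a) = - sign_sum q" using sign_sum_shift[OF q] by simp
  then show "\<exists>q. quad q \<and> sign_sum q = 2 ^ g" "\<exists>q. quad q \<and> sign_sum q = - (2 ^ g)"
    using sign_sum_cases[OF q] q quad_shift[OF q, of a] by force+
qed

end

section \<open>The index of subgroups that fix a vector or a quadratic form\<close>

context symplectic_F2_subgroup
begin

text \<open>The preimage of z under f depends only on the coset H f, and every nonzero vector occurs
  as such a preimage.\<close>

lemma idx_fix_vector:
  assumes z: "z \<noteq> 0" and fixed: "\<And>f. f \<in> H \<Longrightarrow> f z = z"
  shows "4 ^ g - 1 \<le> idx"
proof -
  have "- {0} \<subseteq> (\<lambda>f. ginv f z) ` Isom"
  proof
    fix w assume "w \<in> - {0 :: 'a}"
    then obtain f where f: "f \<in> stab 0" "f w = z" using stab_transitive[of w 0 z] z by auto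
    then have "f \<in> Isom" by (simp add: stab_def)
    then show "w \<in> (\<lambda>f. ginv f z) ` Isom" using f(2) Isom_inv_f by (metis rev_image_eqI)
  qed
  then have "card (- {0 :: 'a}) \<le> card ((\<lambda>f. ginv f z) ` Isom)" by (simp add: card_mono)
  also have "\<dots> \<le> idx"
  proof (rule idx_ge)
    fix f h assume f: "f \<in> Isom" and h: "h \<in> H"
    have "(h \<circ> f) (ginv f z) = z" using fixed[OF h] Isom_f_inv[OF f] by simp
    then show "ginv (h \<circ> f) z = ginv f z" using Isom_inv_f[OF Isom_comp[OF H_Isom[OF h] f]] by metis
  qed
  finally show ?thesis using card_UNIV by (simp add: Compl_eq_Diff_UNIV card_Diff_subset)
qed

text \<open>Over every form in the orbit of q lie two distinct cosets H f and H k f, where k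
  stabilizes q but is not in H.\<close>

lemma idx_proper_in_stabQ:
  assumes q: "quad q" and sub: "H \<subseteq> stabQ q" "H \<noteq> stabQ q"
  shows "card (zeros q) * 2 \<le> idx"
proof -
  obtain k where k: "k \<in> stabQ q" "k \<notin> H" using sub by blast
  have kG: "k \<in> Isom" "q \<circ> k = q" using k by (auto simp: stabQ_iff)
  have "card ((\<lambda>f. q \<circ> f) ` Isom) * 2 \<le> card (coset ` Isom) * 1"
  proof (rule card_mult_disjoint_le)
    let ?A = "\<lambda>q'. {c. \<exists>f\<in>Isom. c = coset f \<and> q \<circ> f = q'}"
    fix q' assume "q' \<in> (\<lambda>f. q \<circ> f) ` Isom"
    then obtain f where f: "f \<in> Isom" "q' = q \<circ> f" by blast
    show "?A q' \<subseteq> coset ` Isom" by auto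
    have "coset f \<noteq> coset (k \<circ> f)"
    proof
      assume "coset f = coset (k \<circ> f)"
      then obtain h where "h \<in> H" "k \<circ> f = h \<circ> f" by (auto simp: coset_eq)
      then have "k \<in> H" using Isom_inv_comp(2)[OF f(1)] by (metis comp_assoc comp_id)
      then show False using k by simp
    qed
    moreover have "{coset f, coset (k \<circ> f)} \<subseteq> ?A q'"
    proof -
      have kf: "q \<circ> (k \<circ> f) = q'" using f(2) kG(2) by (metis comp_assoc)
      have "coset f \<in> ?A q'"
        unfolding mem_Collect_eq by (intro bexI[of _ f] conjI refl f(2)[symmetric] f(1))
      moreover have "coset (k \<circ> f) \<in> ?A q'"
        unfolding mem_Collect_eq by (intro bexI[of _ "k \<circ> f"] conjI refl kf Isom_comp kG(1) f(1))
      ultimately show ?thesis by (simp only: insert_subset empty_subsetI simp_thms)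
    qed
    ultimately show "2 \<le> card (?A q') * 1"
      using card_mono[of "?A q'" "{coset f, coset (k \<circ> f)}"] by simp
    fix q'' assume "q' \<noteq> q''"
    moreover have "q \<circ> f = q \<circ> f'" if eq: "coset f = coset f'" for f f'
    proof -
      obtain h where h: "h \<in> H" "f' = h \<circ> f" using eq by (auto simp: coset_eq)
      then have "q \<circ> h = q" using sub(1) stabQ_iff by blast
      then show ?thesis using h(2) by (metis comp_assoc)
    qed
    ultimately show "?A q' \<inter> ?A q'' = {}" by blast
  qed simp_all
  then show ?thesis by (simp add: idx_def card_orbit_quad[OF q])
qed

theorem small_index_is_orthogonal:
  assumes small: "idx < 2 * (2 ^ (g - 1) * (2 ^ g - 1))" and proper: "H \<noteq> Isom"
  shows "\<exists>q. quad q \<and> H = stabQ q"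
proof -
  have "2 * (2 ^ (g - 1) * (2 ^ g - 1)) = 2 ^ g * (2 ^ g - (1::nat))"
    using g_ge_3 by (simp flip: power_Suc mult.assoc)
  also have "\<dots> = 4 ^ g - 2 ^ g" by (simp add: diff_mult_distrib2 flip: power_mult_distrib)
  finally have N: "2 * (2 ^ (g - 1) * (2 ^ g - 1)) = (4::nat) ^ g - 2 ^ g" .
  \<comment> \<open>Since 2 N^- = 4^g - 2^g, this gap leaves room for the thresholds 4^g - 4 and 4^g
    - 1.\<close>
  have "(8::nat) \<le> 2 ^ g" using power_increasing[of 3 g "2::nat"] g_ge_3 by simp
  moreover have "(2::nat) ^ g \<le> 4 ^ g" by (rule power_mono) auto
  moreover have "idx < 4 ^ g - 2 ^ g" using small unfolding N .
  ultimately have small': "idx + 4 < 4 ^ g" "\<not> 4 ^ g - 1 \<le> idx" by linarith+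
  from small_index_cases[OF small'(1)] show ?thesis
  proof (elim disjE exE conjE)
    assume "H = Isom"
    then show ?thesis using proper by simp
  next
    fix q assume q: "quad q" and inv: "\<forall>f\<in>H. \<forall>x. q (f x) = q x"
    have sub: "H \<subseteq> stabQ q" using H_Isom inv unfolding stabQ_def by blast
    have "m * (n - 1) \<le> m * (n + 1)" for m n :: nat by (intro mult_le_mono2) simp
    then have "2 ^ (g - 1) * (2 ^ g - 1) \<le> card (zeros q)"
      unfolding card_zeros[OF q] by (split if_split) blast
    then have "\<not> card (zeros q) * 2 \<le> idx" using small by linarith
    then show ?thesis using idx_proper_in_stabQ[OF q sub] q by blast
  next
    fix z assume z: "z \<noteq> 0" and fz: "\<forall>f\<in>H. f z = z"
    have "4 ^ g - 1 \<le> idx"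
      by (rule idx_fix_vector[OF z]) (rule bspec[OF fz])
    then show ?thesis using small'(2) by blast
  qed
qed

end

section \<open>The symplectic group over the field with two elements\<close>

lemma UNIV_bit: "(UNIV :: bit set) = {0, 1}"
proof -
  have "x \<in> {0, 1}" for x :: bit by (cases x) auto
  then show ?thesis by blast
qed

instance bit :: finite
  by standard (simp add: UNIV_bit)

lemma bit_eq_iff_one: "a = b \<longleftrightarrow> (a = 1 \<longleftrightarrow> b = 1)" for a b :: bit
  by (cases a; cases b) auto

lemma ex_bit: "(\<exists>k. P k) \<longleftrightarrow> P (0 :: bit) \<or> P 1"
proof
  assume "\<exists>k. P k"
  then obtain k where "P k" by blast
  then show "P 0 \<or> P 1" by (cases k) auto
qed blast

lemma bit_add_eq_one: "a + b = 1 \<longleftrightarrow> (a = 1) \<noteq> (b = 1)" for a b :: bit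
  by (cases a; cases b) auto

lemma bit_diff_eq_one: "a - b = 1 \<longleftrightarrow> (a = 1) \<noteq> (b = 1)" for a b :: bit
  by (cases a; cases b) auto

lemma bit_zero_smult: "0 *s x = 0" for x :: "bit ^ 'n"
  by (simp add: vec_eq_iff)

lemma bit_one_smult: "1 *s x = x" for x :: "bit ^ 'n"
  by (simp add: vec_eq_iff)

lemma bit_vec_dbl: "x + x = 0" for x :: "bit ^ 'n"
proof -
  have "a + a = 0" for a :: bit by (cases a) auto
  then show ?thesis unfolding vec_eq_iff by (simp del: add_bit_eq_xor)
qed

lemma linear_bit_iff:
  fixes f :: "bit ^ 'n \<Rightarrow> bit ^ 'n"
  shows "Vector_Spaces.linear (*s) (*s) f \<longleftrightarrow> (\<forall>x y. f (x + y) = f x + f y)"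
proof
  assume "Vector_Spaces.linear (*s) (*s) f"
  then show "\<forall>x y. f (x + y) = f x + f y" unfolding Vector_Spaces.linear_iff by blast
next
  assume add: "\<forall>x y. f (x + y) = f x + f y"
  have "f 0 = 0" using add[rule_format, of 0 0] by simp
  then have "f (c *s x) = c *s f x" for c x by (cases c) (simp_all add: bit_zero_smult bit_one_smult)
  then show "Vector_Spaces.linear (*s) (*s) f"
    unfolding Vector_Spaces.linear_iff using add vec.vector_space_axioms by blast
qed

lemma card_span_independent:
  fixes A :: "(bit ^ 'n) set"
  assumes "finite A" "vec.independent A"
  shows "card (vec.span A) = 2 ^ card A"
  using assms
proof (induction A)
  case (insert a A)
  have ind: "vec.independent A" "a \<notin> vec.span A"
    using insert by (auto simp: vec.independent_insert)
  have "x \<in> vec.span (insert a A) \<longleftrightarrow> x \<in> vec.span A \<union> (+) a ` vec.span A" for x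
  proof -
    have "- a = a" using bit_vec_dbl[of a] by (metis add_eq_0_iff)
    then have "x - 1 *s a = a + x"
      unfolding bit_one_smult diff_conv_add_uminus by (simp only: add.commute)
    then have "(\<exists>k. x - k *s a \<in> vec.span A) \<longleftrightarrow> x \<in> vec.span A \<or> a + x \<in> vec.span A"
      unfolding ex_bit bit_zero_smult diff_0_right by (simp only:)
    moreover have "x \<in> (+) a ` vec.span A \<longleftrightarrow> a + x \<in> vec.span A"
    proof -
      have aa: "a + (a + y) = y" for y using bit_vec_dbl[of a] by (simp only: add.assoc[symmetric] add_0_left)
      have "x = a + y \<longleftrightarrow> a + x = y" for y using aa by metis
      then show ?thesis by (simp only: image_iff) blast
    qed
    ultimately show ?thesis unfolding vec.span_insert mem_Collect_eq Un_iff by blast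
  qed
  then have "vec.span (insert a A) = vec.span A \<union> (+) a ` vec.span A" by blast
  moreover have "vec.span A \<inter> (+) a ` vec.span A = {}"
  proof (rule ccontr)
    assume "\<not> ?thesis"
    then obtain y where y: "y \<in> vec.span A" "a + y \<in> vec.span A" by auto
    then have "(a + y) - y \<in> vec.span A" by (intro vec.span_diff)
    then show False using ind by simp
  qed
  ultimately have "card (vec.span (insert a A)) = card (vec.span A) + card ((+) a ` vec.span A)"
    by (simp add: card_Un_disjoint)
  also have "card ((+) a ` vec.span A) = card (vec.span A)" by (rule card_image) (auto simp: inj_on_def)
  finally show ?case using insert ind by simp
qed (simp add: vec.span_empty)

lemma card_subspace_bit:
  fixes S :: "(bit ^ 'n) set"
  assumes "vec.subspace S" shows "card S = 2 ^ vec.dim S"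
proof -
  obtain A where A: "A \<subseteq> S" "vec.independent A" "S \<subseteq> vec.span A" "card A = vec.dim S"
    using vec.basis_exists by blast
  have "vec.span A = S" using A assms by (simp add: vec.span_subspace)
  then show ?thesis using card_span_independent[OF _ A(2)] A(4) by simp
qed

section \<open>Transfer to the symplectic group of a form on vectors over the type
  \<open>bit\<close>\<close>

locale symplectic_bit =
  fixes B :: "bit ^ 'n \<Rightarrow> bit ^ 'n \<Rightarrow> bit" and g :: nat
  assumes g: "g \<ge> 3" and card_n: "CARD('n) = 2 * g"
    and alt: "alternating_form B" and nondeg: "nondegenerate B"
begin

lemma B_add: "B (x + y) z = B x z + B y z" "B z (x + y) = B z x + B z y"
  using alt unfolding alternating_form_def bilinear_form_def Vector_Spaces.linear_iff by blast+

lemma B_self: "B x x = 0"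
  using alt by (simp add: alternating_form_def)

lemma B_sym: "B x y = B y x"
proof -
  have "B x y + B y x = B (x + y) (x + y)" using B_self[of x] B_self[of y] by (simp only: B_add add_0_left add_0_right add.commute)
  then have "B x y + B y x = 0" using B_self by simp
  then show ?thesis by (cases "B x y"; cases "B y x") auto
qed

sublocale symplectic_F2 "\<lambda>x y. B x y = 1" g
proof
  show "x + x = 0" for x :: "bit ^ 'n" by (rule bit_vec_dbl)
  show "B (x + y) z = 1 \<longleftrightarrow> (B x z = 1) \<noteq> (B y z = 1)" for x y z
    by (simp only: B_add bit_add_eq_one)
  show "(B x y = 1) = (B y x = 1)" for x y using B_sym by simp
  show "B x x \<noteq> 1" for x by (simp only: B_self) simp
  show "x = 0" if "\<And>y. B x y \<noteq> 1" for x
    using nondeg that unfolding nondegenerate_def by simp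
  have "CARD(bit) = 2" by (simp add: UNIV_bit)
  then show "CARD(bit ^ 'n) = 4 ^ g" by (simp add: card_n power_mult)
  show "3 \<le> g" by (rule g)
qed

lemma carrier_Sp: "carrier (Sp B) = Isom"
proof -
  have "(\<forall>x y. B (f x) (f y) = B x y) \<longleftrightarrow> (\<forall>x y. (B (f x) (f y) = 1) = (B x y = 1))" for f
    using bit_eq_iff_one by metis
  then show ?thesis
    using Isom_bij by (auto simp: Sp_def Isom_def linear_bit_iff)
qed

lemma mult_Sp: "f \<otimes>\<^bsub>Sp B\<^esub> h = f \<circ> h" and one_Sp: "\<one>\<^bsub>Sp B\<^esub> = id"
  by (simp_all add: Sp_def)

lemma group_Sp: "group (Sp B)"
proof (rule groupI)
  fix f assume "f \<in> carrier (Sp B)"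
  then show "\<exists>h\<in>carrier (Sp B). h \<otimes>\<^bsub>Sp B\<^esub> f = \<one>\<^bsub>Sp B\<^esub>"
    unfolding carrier_Sp mult_Sp one_Sp using Isom_inv Isom_inv_comp(1) by blast
qed (simp_all only: carrier_Sp mult_Sp one_Sp Isom_comp Isom_id comp_assoc id_comp)

lemma inv_Sp: "f \<in> Isom \<Longrightarrow> inv\<^bsub>Sp B\<^esub> f = ginv f"
  by (rule group.inv_equality[OF group_Sp]) (simp_all only: carrier_Sp mult_Sp one_Sp Isom_inv Isom_inv_comp)

lemma subgroup_Sp_iff: "subgroup H (Sp B) \<longleftrightarrow> symplectic_F2_subgroup (\<lambda>x y. B x y = 1) g H"
proof
  assume H: "subgroup H (Sp B)"
  have HG: "H \<subseteq> Isom" using subgroup.subset[OF H] by (simp only: carrier_Sp)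
  show "symplectic_F2_subgroup (\<lambda>x y. B x y = 1) g H"
  proof unfold_locales
    show "H \<subseteq> Isom" by (rule HG)
    show "id \<in> H" using subgroup.one_closed[OF H] by (simp only: one_Sp)
    show "f \<circ> h \<in> H" if "f \<in> H" "h \<in> H" for f h
      using subgroup.m_closed[OF H that] by (simp only: mult_Sp)
    show "ginv f \<in> H" if f: "f \<in> H" for f
    proof -
      have "f \<in> Isom" using HG f by blast
      then show ?thesis using subgroup.m_inv_closed[OF H f] inv_Sp by simp
    qed
  qed
next
  assume "symplectic_F2_subgroup (\<lambda>x y. B x y = 1) g H"
  then interpret S: symplectic_F2_subgroup "\<lambda>x y. B x y = 1" g H .
  show "subgroup H (Sp B)"
  proof (rule group.subgroupI[OF group_Sp])
    show "H \<subseteq> carrier (Sp B)" using S.H_sub_Isom by (simp only: carrier_Sp)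
    show "H \<noteq> {}" using S.H_id by blast
    show "inv\<^bsub>Sp B\<^esub> f \<in> H" if "f \<in> H" for f
      using S.H_ginv[OF that] inv_Sp[OF S.H_Isom[OF that]] by simp
    show "f \<otimes>\<^bsub>Sp B\<^esub> h \<in> H" if "f \<in> H" "h \<in> H" for f h
      using S.H_comp[OF that] by (simp only: mult_Sp)
  qed
qed

lemma r_coset_Sp: "H #>\<^bsub>Sp B\<^esub> f = (\<lambda>h. h \<circ> f) ` H"
  unfolding r_coset_def mult_Sp by blast

lemma index_Sp:
  assumes "symplectic_F2_subgroup (\<lambda>x y. B x y = 1) g H"
  shows "subgroup_index (Sp B) H = symplectic_F2_subgroup.idx (\<lambda>x y. B x y = 1) H"
proof -
  interpret S: symplectic_F2_subgroup "\<lambda>x y. B x y = 1" g H by (rule assms)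
  have "rcosets\<^bsub>Sp B\<^esub> H = S.coset ` Isom"
    unfolding RCOSETS_def carrier_Sp r_coset_Sp S.coset_def by blast
  then show ?thesis by (simp only: subgroup_index_def S.idx_def)
qed

lemma conjugate_Sp: "conjugate_subgroups (Sp B) K H \<longleftrightarrow> (\<exists>f\<in>Isom. H = (\<lambda>k. f \<circ> (k \<circ> ginv f)) ` K)"
proof -
  have "f <#\<^bsub>Sp B\<^esub> (K #>\<^bsub>Sp B\<^esub> inv\<^bsub>Sp B\<^esub> f) = (\<lambda>k. f \<circ> (k \<circ> ginv f)) ` K" if "f \<in> Isom" for f
    unfolding l_coset_def r_coset_Sp inv_Sp[OF that] mult_Sp by blast
  then show ?thesis unfolding conjugate_subgroups_def carrier_Sp by auto
qed

lemma conjugate_stabQ: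
  assumes q: "quad q" and q': "quad q'" and eq: "sign_sum q' = sign_sum q"
  shows "conjugate_subgroups (Sp B) (stabQ q) (stabQ q')"
proof -
  obtain a where "\<not> q a" "q' = shift q a" using same_sign_sum_shift[OF q q' eq] by blast
  then have q'T: "q' = q \<circ> transv a" using shift_eq_comp_transv[OF q] by simp
  have gT: "ginv (transv a) = transv a" by (rule Hilbert_Choice.inv_equality) (rule transv_transv)+
  have "stabQ q' = (\<lambda>k. transv a \<circ> (k \<circ> transv a)) ` stabQ q"
  proof (intro Set.set_eqI iffI)
    fix f assume "f \<in> stabQ q'"
    then have f: "f \<in> Isom" "\<And>x. q (transv a (f x)) = q (transv a x)" by (simp_all add: stabQ_def q'T)
    have "q ((transv a \<circ> (f \<circ> transv a)) x) = q x" for x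
      using f(2)[of "transv a x"] by (simp only: transv_transv comp_apply)
    moreover have "transv a \<circ> (f \<circ> transv a) \<in> Isom" by (intro Isom_comp transv_in_Isom f(1))
    ultimately have "transv a \<circ> (f \<circ> transv a) \<in> stabQ q" unfolding stabQ_def by blast
    moreover have "f = transv a \<circ> ((transv a \<circ> (f \<circ> transv a)) \<circ> transv a)" by (simp add: fun_eq_iff)
    ultimately show "f \<in> (\<lambda>k. transv a \<circ> (k \<circ> transv a)) ` stabQ q" by blast
  next
    fix f assume "f \<in> (\<lambda>k. transv a \<circ> (k \<circ> transv a)) ` stabQ q"
    then obtain k where k: "k \<in> stabQ q" and fk: "f = transv a \<circ> (k \<circ> transv a)" by blast
    have kG: "k \<in> Isom" and kq: "q (k x) = q x" for x using k by (auto simp: stabQ_def)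
    have "q' (f x) = q' x" for x by (simp only: q'T fk comp_apply transv_transv kq)
    moreover have "f \<in> Isom" unfolding fk by (intro Isom_comp transv_in_Isom kG)
    ultimately show "f \<in> stabQ q'" unfolding stabQ_def by blast
  qed
  then show ?thesis unfolding conjugate_Sp by (intro bexI[of _ "transv a"]) (simp_all only: gT transv_in_Isom)
qed

lemma polarizes_to_iff: "polarizes_to Q B \<longleftrightarrow> quad (\<lambda>x. Q x = 1)"
proof -
  have xor: "(((a \<noteq> b) \<noteq> c) = d) = (a = ((b \<noteq> c) \<noteq> d))" for a b c d :: bool by auto
  have "Q (x + y) - Q x - Q y = B x y \<longleftrightarrow> (Q (x + y) = 1 \<longleftrightarrow> ((Q x = 1) \<noteq> (Q y = 1)) \<noteq> (B x y = 1))" for x y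
    by (subst bit_eq_iff_one) (simp only: bit_diff_eq_one xor)
  then show ?thesis unfolding polarizes_to_def quad_def by (simp only:)
qed

lemma quadratic_form_iff: "quadratic_form Q \<and> polarizes_to Q B \<longleftrightarrow> quad (\<lambda>x. Q x = 1)"
proof
  assume "quadratic_form Q \<and> polarizes_to Q B"
  then show "quad (\<lambda>x. Q x = 1)" using polarizes_to_iff by blast
next
  assume q: "quad (\<lambda>x. Q x = 1)"
  then have pol: "Q (x + y) - Q x - Q y = B x y" for x y
    unfolding polarizes_to_iff[symmetric] polarizes_to_def by (elim allE)
  have "Q 0 = 0" using quad_0[OF q] by simp
  then have "Q (a *s x) = a\<^sup>2 * Q x" for a x
    by (cases a) (simp_all add: bit_zero_smult bit_one_smult)
  moreover have "bilinear_form B" using alt by (simp add: alternating_form_def)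
  ultimately show "quadratic_form Q \<and> polarizes_to Q B"
    unfolding quadratic_form_def polarizes_to_def pol by blast
qed

lemma stabilizer_eq: "form_stabilizer B Q = stabQ (\<lambda>x. Q x = 1)"
  unfolding form_stabilizer_def stabQ_def carrier_Sp using bit_eq_iff_one by blast

lemma subspace_iff: "vec.subspace S \<longleftrightarrow> subsp S" for S :: "(bit ^ 'n) set"
proof
  assume "subsp S"
  moreover have "c *s x \<in> S" if "0 \<in> S" "x \<in> S" for c x
    using that by (cases c) (simp_all add: bit_zero_smult bit_one_smult)
  ultimately show "vec.subspace S" by (auto simp: vec.subspace_def subsp_def)
qed (auto simp: vec.subspace_def subsp_def)

text \<open>Over F_2 cardinality determines dimension, so a totally singular subspace of greatest
  cardinality attains the Witt index, and \<open>maximal_singular_exists\<close> ties that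
  cardinality to the sign.\<close>

lemma witt_index_eq:
  assumes q: "quad (\<lambda>x. Q x = 1)"
  shows "witt_index Q = (if sign_sum (\<lambda>x. Q x = 1) = 2 ^ g then g else g - 1)"
proof -
  let ?q = "\<lambda>x. Q x = 1"
  have sing: "vec.subspace S \<and> (\<forall>x\<in>S. Q x = 0) \<longleftrightarrow> singular ?q S" for S
    by (simp add: singular_def subspace_iff)
  have card: "card S = 2 ^ vec.dim S" if "singular ?q S" for S
    using that card_subspace_bit sing by blast
  obtain S where S: "singular ?q S" "\<And>S'. singular ?q S' \<Longrightarrow> card S' \<le> card S"
    "card S = 2 ^ g \<and> sign_sum ?q = 2 ^ g \<or> card S = 2 ^ (g - 1) \<and> sign_sum ?q = - (2 ^ g)"
    using maximal_singular_exists[OF q] by metis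
  have "vec.dim S' \<le> vec.dim S" if "singular ?q S'" for S'
    using S(2)[OF that] card[OF that] card[OF S(1)] by simp
  then have "witt_index Q = vec.dim S"
    unfolding witt_index_def sing using S(1) by (intro Max_eqI) auto
  moreover have "(2::int) ^ g \<noteq> - (2 ^ g)"
    using zero_less_power[of "2::int" g] by linarith
  ultimately show ?thesis using S(3) card[OF S(1)] by auto
qed

lemma orthogonal_subgroups_iff:
  "K \<in> orthogonal_subgroups B g \<longleftrightarrow> (\<exists>q. quad q \<and> sign_sum q = 2 ^ g \<and> K = stabQ q)"
  "K \<in> orthogonal_subgroups B (g - 1) \<longleftrightarrow> (\<exists>q. quad q \<and> sign_sum q = - (2 ^ g) \<and> K = stabQ q)"
proof -
  have ne: "(2::int) ^ g \<noteq> - (2 ^ g)" "g - 1 \<noteq> g"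
    using zero_less_power[of "2::int" g] g by linarith+
  have *: "K \<in> orthogonal_subgroups B w \<longleftrightarrow>
    (\<exists>q. quad q \<and> (if sign_sum q = 2 ^ g then g else g - 1) = w \<and> K = stabQ q)" (is "_ \<longleftrightarrow> (\<exists>q. ?P q)") for w
  proof -
    have "K \<in> orthogonal_subgroups B w \<longleftrightarrow> (\<exists>Q :: bit ^ 'n \<Rightarrow> bit. ?P (\<lambda>x. Q x = 1))"
      unfolding orthogonal_subgroups_def mem_Collect_eq stabilizer_eq
      using quadratic_form_iff witt_index_eq by metis
    moreover have "\<exists>Q :: bit ^ 'n \<Rightarrow> bit. (\<lambda>x. Q x = 1) = q" for q
      by (intro exI[of _ "\<lambda>x. if q x then 1 else 0"]) auto
    ultimately show ?thesis by metis
  qed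
  show "K \<in> orthogonal_subgroups B g \<longleftrightarrow> (\<exists>q. quad q \<and> sign_sum q = 2 ^ g \<and> K = stabQ q)"
    unfolding * using ne by metis
  show "K \<in> orthogonal_subgroups B (g - 1) \<longleftrightarrow> (\<exists>q. quad q \<and> sign_sum q = - (2 ^ g) \<and> K = stabQ q)"
    unfolding * using ne sign_sum_cases by metis
qed

lemma subgroup_stabQ: "subgroup (stabQ q) (Sp B)"
  unfolding subgroup_Sp_iff by (rule stabQ_subgroup)

lemma index_stabQ: "quad q \<Longrightarrow> subgroup_index (Sp B) (stabQ q) =
    (if sign_sum q = 2 ^ g then 2 ^ (g - 1) * (2 ^ g + 1) else 2 ^ (g - 1) * (2 ^ g - 1))"
  by (simp only: index_Sp[OF stabQ_subgroup] stabQ_index card_zeros)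

lemma small_index_Sp:
  assumes "subgroup H (Sp B)" "H \<noteq> carrier (Sp B)"
    "subgroup_index (Sp B) H < 2 * (2 ^ (g - 1) * (2 ^ g - 1))"
  shows "\<exists>q. quad q \<and> H = stabQ q"
proof -
  have H: "symplectic_F2_subgroup (\<lambda>x y. B x y = 1) g H" using assms(1) by (simp only: subgroup_Sp_iff)
  show ?thesis
    by (rule symplectic_F2_subgroup.small_index_is_orthogonal[OF H])
      (use assms(2,3) in \<open>simp_all only: index_Sp[OF H] carrier_Sp not_False_eq_True\<close>)
qed

lemma index_carrier: "subgroup_index (Sp B) (carrier (Sp B)) = 1"
proof -
  have "symplectic_F2_subgroup (\<lambda>x y. B x y = 1) g Isom"
    by unfold_locales (simp_all only: Isom_id Isom_comp Isom_inv order.refl)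
  then interpret S: symplectic_F2_subgroup "\<lambda>x y. B x y = 1" g Isom .
  have "S.coset f = Isom" if f: "f \<in> Isom" for f
  proof -
    have "h = (h \<circ> ginv f) \<circ> f" for h using Isom_inv_comp(1)[OF f] by (metis comp_assoc comp_id)
    then show ?thesis unfolding S.coset_def using f by (metis (no_types, lifting) Isom_comp Isom_inv image_eqI subsetI subset_antisym image_subsetI)
  qed
  then have "S.coset ` Isom = (\<lambda>_. Isom) ` Isom" by (intro image_cong refl)
  also have "\<dots> = {Isom}" using Isom_id unfolding image_constant_conv by (metis empty_iff)
  finally have "S.coset ` Isom = {Isom}" .
  then show ?thesis unfolding carrier_Sp index_Sp[OF S.symplectic_F2_subgroup_axioms] S.idx_def by simp
qed

end

theorem theorem0p2:
  fixes B :: "bit ^ 'n \<Rightarrow> bit ^ 'n \<Rightarrow> bit" and g :: nat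
  assumes "g \<ge> 3" and "CARD('n) = 2 * g"
    and "alternating_form B" and "nondegenerate B"
  defines "Nplus \<equiv> 2 ^ (g - 1) * (2 ^ g + 1)"
    and "Nminus \<equiv> 2 ^ (g - 1) * (2 ^ g - 1)"
  shows "orthogonal_subgroups B (g - 1) \<noteq> {} \<and> orthogonal_subgroups B g \<noteq> {} \<and>
    (\<forall>Ominus \<in> orthogonal_subgroups B (g - 1). \<forall>Oplus \<in> orthogonal_subgroups B g.
       unique_subgroup_of_index_upto_conj (Sp B) Ominus Nminus \<and>
       unique_subgroup_of_index_upto_conj (Sp B) Oplus Nplus \<and>
       (\<forall>H. subgroup H (Sp B) \<and> H \<noteq> carrier (Sp B) \<and>
            \<not> conjugate_subgroups (Sp B) Ominus H \<and> \<not> conjugate_subgroups (Sp B) Oplus H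
          \<longrightarrow> subgroup_index (Sp B) H \<ge> 2 * Nminus))"
proof -
  interpret S: symplectic_bit B g by unfold_locales (fact assms)+
  have pow: "(8::nat) \<le> 2 ^ g" using power_increasing[of 3 g "2::nat"] assms(1) by simp
  have lt: "Nminus < Nplus" unfolding Nplus_def Nminus_def using pow by (intro mult_strict_left_mono) auto
  \<comment> \<open>Reduces to 2^g > 3. It puts index N^+ below the bound as well, so
    \<open>small\<close> gives uniqueness for both signs.\<close>
  have lt2: "Nplus < 2 * Nminus"
  proof -
    have "(2::nat) ^ g + 1 < 2 * (2 ^ g - 1)" using pow by linarith
    then have "(2::nat) ^ (g - 1) * (2 ^ g + 1) < 2 ^ (g - 1) * (2 * (2 ^ g - 1))"
      by (intro mult_strict_left_mono) auto
    then show ?thesis unfolding Nplus_def Nminus_def by (simp only: mult.left_commute)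
  qed
  \<comment> \<open>Separates both indices from the index 1 of the whole group.\<close>
  have gt1: "1 < Nminus"
  proof -
    have "1 * 1 < 2 ^ (g - 1) * (2 ^ g - (1::nat))" using pow by (intro mult_le_less_imp_less) auto
    then show ?thesis by (simp add: Nminus_def)
  qed
  have idx: "subgroup_index (Sp B) (S.stabQ q) = (if S.sign_sum q = 2 ^ g then Nplus else Nminus)" if "S.quad q" for q
    unfolding Nplus_def Nminus_def by (rule S.index_stabQ[OF that])
  have small: "\<exists>q. S.quad q \<and> H = S.stabQ q"
    if "subgroup H (Sp B)" "H \<noteq> carrier (Sp B)" "subgroup_index (Sp B) H < 2 * Nminus" for H
    using S.small_index_Sp[OF that(1,2)] that(3) unfolding Nminus_def by blast
  have unique: "unique_subgroup_of_index_upto_conj (Sp B) (S.stabQ q) (if S.sign_sum q = 2 ^ g then Nplus else Nminus)"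
    if q: "S.quad q" for q
    unfolding unique_subgroup_of_index_upto_conj_def
  proof (intro conjI allI impI)
    show "subgroup (S.stabQ q) (Sp B)" by (rule S.subgroup_stabQ)
    show "subgroup_index (Sp B) (S.stabQ q) = (if S.sign_sum q = 2 ^ g then Nplus else Nminus)" by (rule idx[OF q])
    fix H assume H: "subgroup H (Sp B) \<and> subgroup_index (Sp B) H = (if S.sign_sum q = 2 ^ g then Nplus else Nminus)"
    then have "1 < subgroup_index (Sp B) H" "subgroup_index (Sp B) H < 2 * Nminus"
      using lt lt2 gt1 by (auto split: if_splits)
    moreover from this have "H \<noteq> carrier (Sp B)" using S.index_carrier by auto
    ultimately obtain q' where q': "S.quad q'" "H = S.stabQ q'" using small H by blast
    have "S.sign_sum q' = S.sign_sum q"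
      using H idx[OF q'(1)] lt q'(2) S.sign_sum_cases[OF q] S.sign_sum_cases[OF q'(1)] by (auto split: if_splits)
    then show "conjugate_subgroups (Sp B) (S.stabQ q) H" using S.conjugate_stabQ[OF q q'(1)] q'(2) by simp
  qed
  have ne: "- (2 ^ g) \<noteq> (2::int) ^ g" using zero_less_power[of "2::int" g] by linarith
  show ?thesis
  proof (intro conjI ballI allI impI)
    show "orthogonal_subgroups B (g - 1) \<noteq> {}" "orthogonal_subgroups B g \<noteq> {}"
      using S.both_signs_occur unfolding ex_in_conv[symmetric] S.orthogonal_subgroups_iff by metis+
    fix Ominus Oplus assume "Ominus \<in> orthogonal_subgroups B (g - 1)" "Oplus \<in> orthogonal_subgroups B g"
    then obtain qm qp where qm: "S.quad qm" "S.sign_sum qm = - (2 ^ g)" "Ominus = S.stabQ qm"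
      and qp: "S.quad qp" "S.sign_sum qp = 2 ^ g" "Oplus = S.stabQ qp"
      unfolding S.orthogonal_subgroups_iff by blast
    show "unique_subgroup_of_index_upto_conj (Sp B) Ominus Nminus"
      using unique[OF qm(1)] ne by (simp only: qm if_False)
    show "unique_subgroup_of_index_upto_conj (Sp B) Oplus Nplus"
      using unique[OF qp(1)] by (simp only: qp refl if_True)
    fix H assume H: "subgroup H (Sp B) \<and> H \<noteq> carrier (Sp B) \<and>
      \<not> conjugate_subgroups (Sp B) Ominus H \<and> \<not> conjugate_subgroups (Sp B) Oplus H"
    show "2 * Nminus \<le> subgroup_index (Sp B) H"
    proof (rule ccontr)
      assume "\<not> ?thesis"
      then obtain q where q: "S.quad q" "H = S.stabQ q" using small H by (meson not_le)
      then show False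
        using S.sign_sum_cases[OF q(1)] S.conjugate_stabQ[OF qm(1) q(1)] S.conjugate_stabQ[OF qp(1) q(1)] H
        by (auto simp: qm qp)
    qed
  qed
qed

end
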